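(* Let $X$ be an SCLCS, let $n\ge 2$, and let $f:[0,+\infty)^n\to X$ be a locally integrable function. Suppose that $(\lambda_1^0,\dots,\lambda_n^0)\in\Omega_{b}(f)$, $(\lambda_1,\dots,\lambda_n)\in\mathbb C^n$ and $\Re\lambda_j>\Re\lambda_j^0$ for $1\le j\le n$. Then $(\lambda_1,\dots,\lambda_n)\in\Omega_b(f)\cap\Omega(f)$.
   Context: An SCLCS is a Hausdorff sequentially complete locally convex space over $\mathbb C$; $\circledast$ denotes a fundamental system of seminorms defining the topology of $X$. Integration (with respect to Lebesgue measure): for a compact set $K$, a function $f:K\to X$ is integrable if there is a sequence $(f_k)$ of simple functions with $f_k(t)\to f(t)$ for a.e. $t\in K$ and such that for every $\epsilon>0$ and $p\in\circledast$ there is $k_0$ with $\int_K p(f_k-f_m)\le\epsilon$ for all $k,m\ge k_0$; then $\int_K f:=\lim_k\int_K f_k$. A function $f:[0,+\infty)^n\to X$ is locally integrable if its restriction to every compact subset is integrable. For locally integrable $f$ and $\lambda=(\lambda_1,\dots,\lambda_n)\in\mathbb C^n$ put $$I_\lambda(t_1,\dots,t_n):=\int_0^{t_1}\!\!\cdots\int_0^{t_n}e^{-\lambda_1s_1-\dots-\lambda_ns_n}f(s_1,\dots,s_n)\,ds_1\cdots ds_n .$$ $\Omega(f)$ is the set of all $\lambda\in\mathbb C^n$ for which the limit of $I_\lambda(t_1,\dots,t_n)$ as $t_1\to+\infty;\dots;t_n\to+\infty$ exists in $X$, i.e. there is $F(\lambda)\in X$ such that for every $\epsilon>0$ and $p\in\circledast$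 there is $M>0$ with $p(I_\lambda(t_1,\dots,t_n)-F(\lambda))<\epsilon$ whenever $t_j>M$ for all $j$. $\Omega_b(f)$ is the set of all $\lambda\in\mathbb C^n$ such that the set $\{I_\lambda(t_1,\dots,t_n):t_1\ge0,\dots,t_n\ge0\}$ is bounded in $X$. *)

theory Defs
  imports "HOL-Analysis.Analysis"
begin

definition seminorm :: "(complex \<Rightarrow> 'x::ab_group_add \<Rightarrow> 'x) \<Rightarrow> ('x \<Rightarrow> real) \<Rightarrow> bool" where
  "seminorm scl p \<longleftrightarrow>
     (\<forall>x y. p (x + y) \<le> p x + p y) \<and> (\<forall>c x. p (scl c x) = cmod c * p x)"

text \<open>The family \<open>P\<close> need not be directed, hence the finite subfamilies.\<close>

definition fundamental_seminorms ::
    "(complex \<Rightarrow> 'x::ab_group_add \<Rightarrow> 'x) \<Rightarrow> 'x topology \<Rightarrow> ('x \<Rightarrow> real) set \<Rightarrow> bool" where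
  "fundamental_seminorms scl T P \<longleftrightarrow>
     (\<forall>p\<in>P. seminorm scl p) \<and>
     (\<forall>U. openin T U \<longleftrightarrow>
        (\<forall>x\<in>U. \<exists>F \<epsilon>. finite F \<and> F \<subseteq> P \<and> 0 < \<epsilon> \<and> {y. \<forall>p\<in>F. p (y - x) < \<epsilon>} \<subseteq> U))"

definition tvs_Cauchy :: "'x::ab_group_add topology \<Rightarrow> (nat \<Rightarrow> 'x) \<Rightarrow> bool" where
  "tvs_Cauchy T u \<longleftrightarrow>
     (\<forall>U. openin T U \<and> 0 \<in> U \<longrightarrow> (\<exists>N. \<forall>k\<ge>N. \<forall>m\<ge>N. u k - u m \<in> U))"

definition tvs_bounded ::
    "(complex \<Rightarrow> 'x::ab_group_add \<Rightarrow> 'x) \<Rightarrow> 'x topology \<Rightarrow> 'x set \<Rightarrow> bool" where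
  "tvs_bounded scl T B \<longleftrightarrow>
     (\<forall>U. openin T U \<and> 0 \<in> U \<longrightarrow> (\<exists>r>0. \<forall>c. r \<le> cmod c \<longrightarrow> B \<subseteq> scl c ` U))"

text \<open>
  A Hausdorff sequentially complete locally convex space over the complex numbers, carried by
  the whole type \<open>'x\<close>, together with a fundamental system \<open>P\<close> of seminorms.
\<close>

locale sclcs = vector_space scl
  for scl :: "complex \<Rightarrow> 'x::ab_group_add \<Rightarrow> 'x" +
  fixes T :: "'x topology" and P :: "('x \<Rightarrow> real) set"
  assumes fundamental: "fundamental_seminorms scl T P"
    and Hausdorff: "Hausdorff_space T"
    and sequentially_complete: "\<And>u. tvs_Cauchy T u \<Longrightarrow> \<exists>l. limitin T u l sequentially"

definition simple_integral_on ::
    "(complex \<Rightarrow> 'x::ab_group_add \<Rightarrow> 'x) \<Rightarrow> (real ^ 'n) set \<Rightarrow> (real ^ 'n \<Rightarrow> 'x) \<Rightarrow> 'x" where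
  "simple_integral_on scl K g =
     (\<Sum>y\<in>g ` K. scl (of_real (measure lebesgue (g -` {y} \<inter> K))) y)"

text \<open>
  On a compact \<open>K\<close> the real integrand below is itself a simple function on a space of finite
  measure, so its integral is never the default value of a non-integrable function.
\<close>

definition approx_simple ::
    "'x::ab_group_add topology \<Rightarrow> ('x \<Rightarrow> real) set \<Rightarrow> (real ^ 'n) set \<Rightarrow>
     (real ^ 'n \<Rightarrow> 'x) \<Rightarrow> (nat \<Rightarrow> real ^ 'n \<Rightarrow> 'x) \<Rightarrow> bool" where
  "approx_simple T P K f s \<longleftrightarrow>
     (\<forall>k. simple_function (lebesgue_on K) (s k)) \<and>
     (AE t in lebesgue_on K. limitin T (\<lambda>k. s k t) (f t) sequentially) \<and>
     (\<forall>\<epsilon>>0. \<forall>p\<in>P. \<exists>k0. \<forall>k\<ge>k0. \<forall>m\<ge>k0.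
        (LINT t|lebesgue_on K. p (s k t - s m t)) \<le> \<epsilon>)"

definition integrable_K ::
    "'x::ab_group_add topology \<Rightarrow> ('x \<Rightarrow> real) set \<Rightarrow> (real ^ 'n) set \<Rightarrow>
     (real ^ 'n \<Rightarrow> 'x) \<Rightarrow> bool" where
  "integrable_K T P K f \<longleftrightarrow> (\<exists>s. approx_simple T P K f s)"

definition integral_K ::
    "(complex \<Rightarrow> 'x::ab_group_add \<Rightarrow> 'x) \<Rightarrow> 'x topology \<Rightarrow> ('x \<Rightarrow> real) set \<Rightarrow>
     (real ^ 'n) set \<Rightarrow> (real ^ 'n \<Rightarrow> 'x) \<Rightarrow> 'x" where
  "integral_K scl T P K f =
     (THE J. \<exists>s. approx_simple T P K f s \<and>
        limitin T (\<lambda>k. simple_integral_on scl K (s k)) J sequentially)"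

definition orthant :: "(real ^ 'n) set" where
  "orthant = {t. \<forall>j. 0 \<le> t $ j}"

text \<open>Only the values of \<open>f\<close> on the orthant matter, here and in what follows.\<close>

definition locally_integrable ::
    "'x::ab_group_add topology \<Rightarrow> ('x \<Rightarrow> real) set \<Rightarrow> (real ^ 'n \<Rightarrow> 'x) \<Rightarrow> bool" where
  "locally_integrable T P f \<longleftrightarrow> (\<forall>K. compact K \<and> K \<subseteq> orthant \<longrightarrow> integrable_K T P K f)"

text \<open>
  The integral from \<open>0\<close> to \<open>t\<^sub>1\<close>, ..., \<open>0\<close> to \<open>t\<^sub>n\<close> is the integral over the compact box
  \<open>cbox 0 t\<close>.
\<close>

definition partial_laplace ::
    "(complex \<Rightarrow> 'x::ab_group_add \<Rightarrow> 'x) \<Rightarrow> 'x topology \<Rightarrow> ('x \<Rightarrow> real) set \<Rightarrow>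
     (real ^ 'n \<Rightarrow> 'x) \<Rightarrow> complex ^ 'n \<Rightarrow> real ^ 'n \<Rightarrow> 'x" where
  "partial_laplace scl T P f lam t =
     integral_K scl T P (cbox 0 t)
       (\<lambda>s. scl (exp (- (\<Sum>j\<in>UNIV. lam $ j * complex_of_real (s $ j)))) (f s))"

definition Omega ::
    "(complex \<Rightarrow> 'x::ab_group_add \<Rightarrow> 'x) \<Rightarrow> 'x topology \<Rightarrow> ('x \<Rightarrow> real) set \<Rightarrow>
     (real ^ 'n \<Rightarrow> 'x) \<Rightarrow> (complex ^ 'n) set" where
  "Omega scl T P f =
     {lam. \<exists>F. \<forall>\<epsilon>>0. \<forall>p\<in>P. \<exists>M>0. \<forall>t. (\<forall>j. M < t $ j) \<longrightarrow>
        p (partial_laplace scl T P f lam t - F) < \<epsilon>}"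

definition Omega_b ::
    "(complex \<Rightarrow> 'x::ab_group_add \<Rightarrow> 'x) \<Rightarrow> 'x topology \<Rightarrow> ('x \<Rightarrow> real) set \<Rightarrow>
     (real ^ 'n \<Rightarrow> 'x) \<Rightarrow> (complex ^ 'n) set" where
  "Omega_b scl T P f =
     {lam. tvs_bounded scl T (partial_laplace scl T P f lam ` orthant)}"

end

theory Submission
  imports Defs
begin

text \<open>
  Put \<open>\<mu> = \<lambda> - \<lambda>\<^sup>0\<close>, so that the integrand for \<open>\<lambda>\<close> is the one for \<open>\<lambda>\<^sup>0\<close> times the product of the
  factors \<open>exp (- \<mu>\<^sub>j s\<^sub>j)\<close>. On a bounded interval, \<open>exp (- \<mu>\<^sub>j s)\<close> restricted to \<open>s \<le> t\<close> is a
  uniform limit of combinations of indicators of initial segments whose coefficients have total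
  mass at most \<open>\<bar>\<mu>\<^sub>j\<bar> / Re \<mu>\<^sub>j\<close>; restricted to \<open>a < s \<le> t\<close>, the mass is at most
  \<open>2 (\<bar>\<mu>\<^sub>j\<bar> / Re \<mu>\<^sub>j) exp (- Re \<mu>\<^sub>j a)\<close>. Inserting such combinations turns the integral for \<open>\<lambda>\<close> into a
  combination of partial integrals for \<open>\<lambda>\<^sup>0\<close>, so every seminorm of it is at most the product of the
  masses times the bound for \<open>\<lambda>\<^sup>0\<close>. This discrete integration by parts needs neither Fubini's
  theorem nor continuous vector-valued integrands. The first mass estimate gives boundedness; the
  second, applied to a change of a single coordinate beyond \<open>a\<close>, gives the Cauchy property, and
  sequential completeness the limit.
\<close>

subsection \<open>Step approximation of decaying exponentials\<close>

text \<open>For decaying exponentials, \<open>C\<close> can be chosen independently of \<open>b\<close>.\<close>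

definition step_approx :: "real \<Rightarrow> real \<Rightarrow> (real \<Rightarrow> complex) \<Rightarrow> bool" where
  "step_approx b C h \<longleftrightarrow> h \<in> borel_measurable borel \<and>
     (\<forall>\<epsilon>>0. \<exists>N (c :: nat \<Rightarrow> complex) a. (\<forall>i<N. 0 \<le> a i \<and> a i \<le> b) \<and> (\<Sum>i<N. cmod (c i)) \<le> C \<and>
        (\<forall>x\<in>{0..b}. cmod (h x - (\<Sum>i<N. c i * indicator {..a i} x)) \<le> \<epsilon>))"

lemma step_approxE:
  assumes h: "step_approx b C h" and \<epsilon>: "0 < \<epsilon>"
  obtains N c a where "\<forall>i<N::nat. 0 \<le> a i \<and> a i \<le> b" "(\<Sum>i<N. cmod (c i)) \<le> C"
    "\<forall>x\<in>{0..b}. cmod (h x - (\<Sum>i<N. c i * indicator {..a i} x)) \<le> \<epsilon>"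
  using h[unfolded step_approx_def, THEN conjunct2, rule_format, OF \<epsilon>] that by blast

text \<open>A single approximation with error \<open>1\<close> suffices, because a combination of
  indicators never exceeds its total mass in modulus. This makes the functions usable as bounded
  weights.\<close>

lemma step_approx_bounded:
  assumes "step_approx b C h" "x \<in> {0..b}" shows "cmod (h x) \<le> C + 1"
proof -
  obtain N c a where N: "(\<Sum>i<N::nat. cmod (c i)) \<le> C"
      "\<forall>x\<in>{0..b}. cmod (h x - (\<Sum>i<N. c i * indicator {..a i} x)) \<le> 1"
    by (rule step_approxE[OF assms(1) zero_less_one])
  have "cmod (\<Sum>i<N. c i * indicator {..a i} x) \<le> (\<Sum>i<N. cmod (c i))"
    by (intro sum_norm_le) (simp add: norm_mult indicator_def)
  moreover have "cmod (h x - (\<Sum>i<N. c i * indicator {..a i} x)) \<le> 1" using N assms(2) by blast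
  ultimately show ?thesis
    using N(1) norm_triangle_sub[of "h x" "\<Sum>i<N. c i * indicator {..a i} x"] by linarith
qed

text \<open>The extra indicator is appended as the term of index \<open>N\<close>, which raises the
  mass by \<open>cmod d\<close>. It is used to cancel a function on an initial segment where it is
  constant.\<close>

lemma step_approx_add_indicator:
  assumes h: "step_approx b C h" and a: "0 \<le> a" "a \<le> b"
  shows "step_approx b (C + cmod d) (\<lambda>x. h x + d * indicator {..a} x)"
  unfolding step_approx_def
proof (intro conjI allI impI)
  show "(\<lambda>x. h x + d * indicator {..a} x) \<in> borel_measurable borel"
    using h unfolding step_approx_def by (intro borel_measurable_add borel_measurable_times) auto
  fix \<epsilon> :: real assume "0 < \<epsilon>"
  then obtain N c \<alpha> where N: "\<forall>i<N::nat. 0 \<le> \<alpha> i \<and> \<alpha> i \<le> b" "(\<Sum>i<N. cmod (c i)) \<le> C"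
      "\<forall>x\<in>{0..b}. cmod (h x - (\<Sum>i<N. c i * indicator {..\<alpha> i} x)) \<le> \<epsilon>"
    by (rule step_approxE[OF h])
  have eq: "(\<Sum>i<N. (c(N := d)) i * indicator {..(\<alpha>(N := a)) i} x) = (\<Sum>i<N. c i * indicator {..\<alpha> i} x)" for x
    by (intro sum.cong) auto
  have eq': "(\<Sum>i<N. cmod ((c(N := d)) i)) = (\<Sum>i<N. cmod (c i))"
    by (intro sum.cong) auto
  show "\<exists>(N::nat) c \<alpha>. (\<forall>i<N. 0 \<le> \<alpha> i \<and> \<alpha> i \<le> b) \<and> (\<Sum>i<N. cmod (c i)) \<le> C + cmod d \<and>
      (\<forall>x\<in>{0..b}. cmod (h x + d * indicator {..a} x - (\<Sum>i<N. c i * indicator {..\<alpha> i} x)) \<le> \<epsilon>)"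
    using N a eq' by (intro exI[of _ "Suc N"] exI[of _ "c(N := d)"] exI[of _ "\<alpha>(N := a)"])
      (auto simp: eq less_Suc_eq algebra_simps)
qed

text \<open>The approximation condition sees only the values on \<open>{0..b}\<close>, whereas
  measurability concerns the whole line; hence measurability of \<open>g\<close> is assumed
  separately.\<close>

lemma step_approx_cong:
  assumes "step_approx b C h" "C \<le> C'" "g \<in> borel_measurable borel" "\<And>x. 0 \<le> x \<Longrightarrow> x \<le> b \<Longrightarrow> g x = h x"
  shows "step_approx b C' g"
  unfolding step_approx_def
proof (intro conjI allI impI assms(3))
  fix \<epsilon> :: real assume "0 < \<epsilon>"
  then obtain N c \<alpha> where N: "\<forall>i<N::nat. 0 \<le> \<alpha> i \<and> \<alpha> i \<le> b" "(\<Sum>i<N. cmod (c i)) \<le> C"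
      "\<forall>x\<in>{0..b}. cmod (h x - (\<Sum>i<N. c i * indicator {..\<alpha> i} x)) \<le> \<epsilon>"
    by (rule step_approxE[OF assms(1)])
  then show "\<exists>(N::nat) c \<alpha>. (\<forall>i<N. 0 \<le> \<alpha> i \<and> \<alpha> i \<le> b) \<and> (\<Sum>i<N. cmod (c i)) \<le> C' \<and>
      (\<forall>x\<in>{0..b}. cmod (g x - (\<Sum>i<N. c i * indicator {..\<alpha> i} x)) \<le> \<epsilon>)"
    using assms(2,4) by (intro exI[of _ N] exI[of _ c] exI[of _ \<alpha>]) auto
qed

text \<open>Mean value inequality with a majorant: the derivative of \<open>exp (- \<mu> x)\<close>
  has modulus \<open>cmod \<mu> * exp (- Re \<mu> x)\<close>, which is the derivative of
  \<open>- (cmod \<mu> / Re \<mu>) * exp (- Re \<mu> x)\<close>. The right-hand side telescopes over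
  a partition, so the total variation is bounded independently of the length of the
  interval.\<close>

lemma norm_exp_minus_diff_le:
  assumes \<mu>: "0 < Re \<mu>" and uv: "u \<le> v"
  shows "cmod (exp (- (\<mu> * of_real u)) - exp (- (\<mu> * of_real v))) \<le>
    cmod \<mu> / Re \<mu> * (exp (- (Re \<mu> * u)) - exp (- (Re \<mu> * v)))"
proof (cases "u = v")
  case False
  define R where "R = cmod \<mu> / Re \<mu>"
  have "norm (exp (- (\<mu> * of_real v)) - exp (- (\<mu> * of_real u))) \<le>
     (- R * exp (- (Re \<mu> * v))) - (- R * exp (- (Re \<mu> * u)))"
  proof (rule differentiable_bound_general[where f = "\<lambda>x. exp (- (\<mu> * of_real x))"
        and \<phi> = "\<lambda>x. - R * exp (- (Re \<mu> * x))" and f' = "\<lambda>x. - \<mu> * exp (- (\<mu> * of_real x))"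
        and \<phi>' = "\<lambda>x. R * Re \<mu> * exp (- (Re \<mu> * x))"])
    show "u < v" using uv False by simp
    show "((\<lambda>x. exp (- (\<mu> * of_real x))) has_vector_derivative - \<mu> * exp (- (\<mu> * of_real x))) (at x)" for x
      by (auto intro!: derivative_eq_intros has_vector_derivative_real_field)
    show "((\<lambda>x. - R * exp (- (Re \<mu> * x))) has_vector_derivative R * Re \<mu> * exp (- (Re \<mu> * x))) (at x)" for x
      unfolding has_real_derivative_iff_has_vector_derivative[symmetric]
      by (auto intro!: derivative_eq_intros)
    show "norm (- \<mu> * exp (- (\<mu> * of_real x))) \<le> R * Re \<mu> * exp (- (Re \<mu> * x))" for x
      using \<mu> by (simp add: R_def norm_mult)
  qed (auto intro!: continuous_intros)
  then show ?thesis by (simp add: R_def norm_minus_commute algebra_simps)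
qed simp

text \<open>Follows from the previous bound by \<open>1 - exp (- y) \<le> y\<close>. The previous
  bound controls the mass of a step approximation, this one its uniform error on a fine
  grid.\<close>

lemma norm_exp_minus_diff_le_linear:
  assumes \<mu>: "0 < Re \<mu>" and uv: "0 \<le> u" "u \<le> v"
  shows "cmod (exp (- (\<mu> * of_real u)) - exp (- (\<mu> * of_real v))) \<le> cmod \<mu> * (v - u)"
proof -
  have "exp (- (Re \<mu> * u)) - exp (- (Re \<mu> * v)) = exp (- (Re \<mu> * u)) * (1 - exp (- (Re \<mu> * (v - u))))"
    by (simp add: algebra_simps exp_diff exp_minus field_simps)
  also have "\<dots> \<le> 1 * (Re \<mu> * (v - u))"
    using \<mu> uv exp_ge_add_one_self[of "- (Re \<mu> * (v - u))"] by (intro mult_mono) auto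
  finally have "cmod \<mu> / Re \<mu> * (exp (- (Re \<mu> * u)) - exp (- (Re \<mu> * v))) \<le> cmod \<mu> / Re \<mu> * (Re \<mu> * (v - u))"
    using \<mu> by (intro mult_left_mono) auto
  then show ?thesis using norm_exp_minus_diff_le[OF \<mu> uv(2)] \<mu> by simp
qed

text \<open>Abel summation on an equidistant grid of \<open>[a, t]\<close>. Freezing the argument at
  \<open>a\<close> by \<open>max x a\<close> makes the function constant up to \<open>a\<close>, so
  that the mass depends only on the decay beyond \<open>a\<close> and carries the factor
  \<open>exp (- (Re \<mu> * a))\<close>.\<close>

lemma step_approx_exp_max:
  assumes \<mu>: "0 < Re \<mu>" and a: "0 \<le> a" "a \<le> t" "t \<le> b"
  shows "step_approx b (cmod \<mu> / Re \<mu> * exp (- (Re \<mu> * a)))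
    (\<lambda>x. indicator {..t} x * exp (- (\<mu> * of_real (max x a))))"
  unfolding step_approx_def
proof (intro conjI allI impI)
  show "(\<lambda>x. indicator {..t} x * exp (- (\<mu> * of_real (max x a)))) \<in> borel_measurable borel"
    by measurable
  fix \<epsilon> :: real assume e: "0 < \<epsilon>"
  \<comment> \<open>With \<open>N\<close> intervals the mesh is \<open>(t - a) / N\<close>, and the
    exponential varies by at most \<open>cmod \<mu>\<close> times the mesh over one interval, hence
    by at most \<open>\<epsilon>\<close>.\<close>
  obtain N where N: "cmod \<mu> * (t - a) / \<epsilon> < real N" using reals_Archimedean2 by blast
  have N0: "0 < real N" using N a e by (smt (verit) divide_nonneg_pos mult_nonneg_nonneg norm_ge_zero)
  define \<tau> where "\<tau> i = a + real i * ((t - a) / real N)" for i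
  have \<tau>: "\<tau> i \<le> \<tau> j" if "i \<le> j" for i j
    unfolding \<tau>_def using that a N0 by (intro add_left_mono mult_right_mono) auto
  have \<tau>0: "\<tau> 0 = a" and \<tau>N: "\<tau> N = t" using N0 by (simp_all add: \<tau>_def)
  define e where "e i = exp (- (\<mu> * of_real (\<tau> i)))" for i
  define E where "E i = exp (- (Re \<mu> * \<tau> i))" for i
  \<comment> \<open>Increments of the exponential as coefficients, with its last value on top, so
    that the partial sum from any index \<open>i\<close> to \<open>N\<close> collapses to
    \<open>e i\<close>.\<close>
  define c where "c i = (if i < N then e i - e (Suc i) else e N)" for i
  define R where "R = cmod \<mu> / Re \<mu>"
  have R: "1 \<le> R" using \<mu> complex_Re_le_cmod[of \<mu>] by (simp add: R_def)
  have "(\<Sum>i<Suc N. cmod (c i)) = (\<Sum>i<N. cmod (e i - e (Suc i))) + E N"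
    by (simp add: c_def e_def E_def)
  also have "\<dots> \<le> (\<Sum>i<N. R * (E i - E (Suc i))) + E N"
    unfolding e_def E_def R_def by (intro add_right_mono sum_mono norm_exp_minus_diff_le \<mu> \<tau>) simp
  also have "\<dots> = R * (E 0 - E N) + E N"
    by (simp only: sum_distrib_left[symmetric] sum_lessThan_telescope')
  \<comment> \<open>Because \<open>1 \<le> R\<close>, the last coefficient \<open>E N\<close> is
    absorbed by the telescoped term \<open>- R * E N\<close>.\<close>
  also have "\<dots> \<le> R * E 0" using R mult_right_mono[OF R, of "E N"] by (simp add: E_def algebra_simps)
  finally have c: "(\<Sum>i<Suc N. cmod (c i)) \<le> R * exp (- (Re \<mu> * a))" by (simp add: E_def \<tau>0)
  have "cmod (indicator {..t} x * exp (- (\<mu> * of_real (max x a))) - (\<Sum>i<Suc N. c i * indicator {..\<tau> i} x)) \<le> \<epsilon>"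
    if x: "0 \<le> x" for x
  proof (cases "x \<le> t")
    case False
    have "indicator {..\<tau> i} x = (0 :: complex)" if "i < Suc N" for i
      using \<tau>[of i N] that False by (simp add: \<tau>N)
    then show ?thesis using False assms(1) \<open>0 < \<epsilon>\<close> by simp
  next
    case True
    \<comment> \<open>The first grid point not to the left of \<open>x\<close>: exactly the
      indicators with index at least \<open>i0\<close> are \<open>1\<close> at \<open>x\<close>, and
      their coefficients sum to \<open>e i0\<close>.\<close>
    define i0 where "i0 = (LEAST i. x \<le> \<tau> i)"
    have i0: "x \<le> \<tau> i0" "i0 \<le> N"
      unfolding i0_def using True \<tau>N by (auto intro: LeastI[of _ N] Least_le)
    have i0': "x \<le> \<tau> i \<longleftrightarrow> i0 \<le> i" for i
      using i0(1) \<tau>[of i0 i] Least_le[of "\<lambda>i. x \<le> \<tau> i" i] unfolding i0_def by fastforce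
    have "(\<Sum>i<Suc N. c i * indicator {..\<tau> i} x) = (\<Sum>i<N. (e i - e (Suc i)) * indicator {..\<tau> i} x) + e N"
      using True by (simp add: c_def \<tau>N)
    also have "(\<Sum>i<N. (e i - e (Suc i)) * indicator {..\<tau> i} x) = (\<Sum>i=i0..<N. e i - e (Suc i))"
      by (rule sum.mono_neutral_cong_right) (auto simp: i0' indicator_def)
    also have "\<dots> = e i0 - e N"
      using sum_Suc_diff'[OF i0(2), of "\<lambda>i. - e i"] by simp
    finally have S: "(\<Sum>i<Suc N. c i * indicator {..\<tau> i} x) = e i0" by simp
    have "cmod (exp (- (\<mu> * of_real (max x a))) - e i0) \<le> cmod \<mu> * (\<tau> i0 - max x a)"
      unfolding e_def using \<tau>[of 0 i0] i0 a x by (intro norm_exp_minus_diff_le_linear \<mu>) (auto simp: \<tau>0)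
    also have "\<dots> \<le> cmod \<mu> * ((t - a) / real N)"
    proof (intro mult_left_mono norm_ge_zero)
      show "\<tau> i0 - max x a \<le> (t - a) / real N"
      \<comment> \<open>For \<open>i0 = 0\<close> the point \<open>max x a\<close> is not below the
        grid point \<open>a\<close>; otherwise minimality of \<open>i0\<close> puts \<open>x\<close>
        to the right of the preceding grid point, one mesh away.\<close>
      proof (cases i0)
        case 0
        have "a - max x a \<le> 0" "0 \<le> (t - a) / real N" using a N0 by auto
        then show ?thesis unfolding 0 \<tau>0 by linarith
      next
        case (Suc i)
        then have "\<tau> i < x" using i0'[of i] by simp
        moreover have "\<tau> i0 = \<tau> i + (t - a) / real N"
          unfolding \<tau>_def Suc of_nat_Suc distrib_right by simp
        ultimately show ?thesis by simp
      qed
    qed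
    also have "\<dots> \<le> \<epsilon>" using N N0 \<open>0 < \<epsilon>\<close> by (simp add: field_simps)
    finally show ?thesis unfolding S using True by simp
  qed
  moreover have "0 \<le> \<tau> i \<and> \<tau> i \<le> b" if "i < Suc N" for i
    using that \<tau>[of 0 i] \<tau>[of i N] a by (simp add: \<tau>0 \<tau>N)
  ultimately show "\<exists>(N::nat) c \<alpha>. (\<forall>i<N. 0 \<le> \<alpha> i \<and> \<alpha> i \<le> b) \<and>
      (\<Sum>i<N. cmod (c i)) \<le> cmod \<mu> / Re \<mu> * exp (- (Re \<mu> * a)) \<and>
      (\<forall>x\<in>{0..b}. cmod (indicator {..t} x * exp (- (\<mu> * of_real (max x a))) -
        (\<Sum>i<N. c i * indicator {..\<alpha> i} x)) \<le> \<epsilon>)"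
    using c unfolding R_def
    by (intro exI[of _ "Suc N"] exI[of _ c] exI[of _ \<tau>] conjI) (blast, assumption, simp del: sum.lessThan_Suc)
qed

lemma step_approx_exp:
  assumes "0 < Re \<mu>" "0 \<le> t" "t \<le> b"
  shows "step_approx b (cmod \<mu> / Re \<mu>) (\<lambda>x. indicator {..t} x * exp (- (\<mu> * of_real x)))"
proof (rule step_approx_cong[OF step_approx_exp_max[OF assms(1) order.refl assms(2,3)]])
  show "(\<lambda>x. indicator {..t} x * exp (- (\<mu> * of_real x))) \<in> borel_measurable borel"
    by measurable
qed auto

lemma step_approx_exp_Ioc:
  assumes \<mu>: "0 < Re \<mu>" and a: "0 \<le> a" "a \<le> t" "t \<le> b"
  shows "step_approx b (2 * (cmod \<mu> / Re \<mu>) * exp (- (Re \<mu> * a)))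
    (\<lambda>x. indicator {a<..t} x * exp (- (\<mu> * of_real x)))"
proof (rule step_approx_cong[OF step_approx_add_indicator[OF step_approx_exp_max[OF \<mu> a], of a "- exp (- (\<mu> * of_real a))"]])
  have "1 \<le> cmod \<mu> / Re \<mu>" using \<mu> complex_Re_le_cmod[of \<mu>] by simp
  from mult_right_mono[OF this, of "exp (- (Re \<mu> * a))"]
  show "cmod \<mu> / Re \<mu> * exp (- (Re \<mu> * a)) + cmod (- exp (- (\<mu> * of_real a))) \<le>
      2 * (cmod \<mu> / Re \<mu>) * exp (- (Re \<mu> * a))"
    by simp
  show "(\<lambda>x. indicator {a<..t} x * exp (- (\<mu> * of_real x))) \<in> borel_measurable borel"
    by measurable
qed (use a in \<open>auto simp: indicator_def max_def\<close>)

subsection \<open>Seminorms and integrals\<close>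

context sclcs
begin

lemma seminorm_P: "p \<in> P \<Longrightarrow> seminorm scl p"
  using fundamental by (simp add: fundamental_seminorms_def)

lemma p_triangle: "p \<in> P \<Longrightarrow> p (x + y) \<le> p x + p y"
  using seminorm_P by (simp add: seminorm_def)

lemma p_scale: "p \<in> P \<Longrightarrow> p (scl c x) = cmod c * p x"
  using seminorm_P by (simp add: seminorm_def)

lemma p_zero: "p \<in> P \<Longrightarrow> p 0 = 0"
  using p_scale[of p 0 0] by simp

lemma p_minus: "p \<in> P \<Longrightarrow> p (- x) = p x"
  using p_scale[of p "-1" x] by simp

lemma p_nonneg: "p \<in> P \<Longrightarrow> 0 \<le> p x"
  using p_triangle[of p x "- x"] by (simp add: p_minus p_zero)

lemma p_commute: "p \<in> P \<Longrightarrow> p (x - y) = p (y - x)"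
  using p_minus[of p "x - y"] by simp

lemma p_triangle_diff: "p \<in> P \<Longrightarrow> p (x - z) \<le> p (x - y) + p (y - z)"
  using p_triangle[of p "x - y" "y - z"] by simp

lemma p_le_diff: "p \<in> P \<Longrightarrow> p x \<le> p (x - y) + p y"
  using p_triangle[of p "x - y" y] by simp

lemma p_abs_diff_le: "p \<in> P \<Longrightarrow> \<bar>p x - p y\<bar> \<le> p (x - y)"
  using p_le_diff[of p x y] p_le_diff[of p y x] p_commute[of p x y] by simp

lemma p_sum: "p \<in> P \<Longrightarrow> p (sum g A) \<le> (\<Sum>i\<in>A. p (g i))"
proof (induction A rule: infinite_finite_induct)
  case (insert i A)
  then show ?case using p_triangle[of p "g i" "sum g A"] by simp
qed (simp_all add: p_zero)

section \<open>Convergence, completeness and boundedness in terms of seminorms\<close>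

lemma openin_iff:
  "openin T U \<longleftrightarrow> (\<forall>x\<in>U. \<exists>F \<epsilon>. finite F \<and> F \<subseteq> P \<and> 0 < \<epsilon> \<and> {y. \<forall>p\<in>F. p (y - x) < \<epsilon>} \<subseteq> U)"
  using fundamental by (simp add: fundamental_seminorms_def)

lemma topspace_T: "topspace T = UNIV"
proof -
  have "openin T UNIV"
    unfolding openin_iff by (auto intro!: exI[of _ "{}"] exI[of _ "1::real"])
  then show ?thesis using openin_subset by blast
qed

lemma openin_p_ball:
  assumes p: "p \<in> P" shows "openin T {y. p (y - x) < \<epsilon>}"
  unfolding openin_iff
proof
  fix z assume z: "z \<in> {y. p (y - x) < \<epsilon>}"
  have "{y. p (y - z) < \<epsilon> - p (z - x)} \<subseteq> {y. p (y - x) < \<epsilon>}"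
    using p_triangle_diff[OF p, of _ x z] by (smt (verit) Collect_mono)
  then show "\<exists>F d. finite F \<and> F \<subseteq> P \<and> 0 < d \<and> {y. \<forall>q\<in>F. q (y - z) < d} \<subseteq> {y. p (y - x) < \<epsilon>}"
    using z p by (intro exI[of _ "{p}"] exI[of _ "\<epsilon> - p (z - x)"]) auto
qed

lemma limitin_iff:
  "limitin T u l sequentially \<longleftrightarrow> (\<forall>p\<in>P. (\<lambda>k. p (u k - l)) \<longlonglongrightarrow> 0)"
proof
  assume L: "limitin T u l sequentially"
  show "\<forall>p\<in>P. (\<lambda>k. p (u k - l)) \<longlonglongrightarrow> 0"
  proof
    fix p assume p: "p \<in> P"
    show "(\<lambda>k. p (u k - l)) \<longlonglongrightarrow> 0"
      unfolding tendsto_iff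
    proof (intro allI impI)
      fix e :: real assume "0 < e"
      then have "eventually (\<lambda>k. u k \<in> {y. p (y - l) < e}) sequentially"
        using L openin_p_ball[OF p, of l e] p_zero[OF p] unfolding limitin_def by auto
      then show "eventually (\<lambda>k. dist (p (u k - l)) 0 < e) sequentially"
        by (simp add: p_nonneg[OF p])
    qed
  qed
next
  assume L: "\<forall>p\<in>P. (\<lambda>k. p (u k - l)) \<longlonglongrightarrow> 0"
  show "limitin T u l sequentially"
    unfolding limitin_def
  proof (intro conjI allI impI)
    fix U assume "openin T U \<and> l \<in> U"
    then obtain F \<epsilon> where F: "finite F" "F \<subseteq> P" "0 < \<epsilon>" "{y. \<forall>p\<in>F. p (y - l) < \<epsilon>} \<subseteq> U"
      unfolding openin_iff by blast
    have "eventually (\<lambda>k. \<forall>p\<in>F. p (u k - l) < \<epsilon>) sequentially"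
    proof (rule eventually_ball_finite[OF F(1)], rule ballI)
      fix p assume "p \<in> F"
      then show "eventually (\<lambda>k. p (u k - l) < \<epsilon>) sequentially"
        using L F by (intro order_tendstoD(2)[of _ 0]) auto
    qed
    then show "eventually (\<lambda>k. u k \<in> U) sequentially"
      by (rule eventually_mono) (use F(4) in blast)
  qed (simp add: topspace_T)
qed

text \<open>The Hausdorff axiom enters here. Identities between integrals are later proved by
  showing that both sides are limits of the same sequence.\<close>

lemma limit_unique:
  assumes "\<And>p. p \<in> P \<Longrightarrow> (\<lambda>k. p (u k - l)) \<longlonglongrightarrow> 0"
    and "\<And>p. p \<in> P \<Longrightarrow> (\<lambda>k. p (u k - l')) \<longlonglongrightarrow> 0"
  shows "l = l'"
  by (rule limitin_Hausdorff_unique[of T u l sequentially l'])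
    (use assms Hausdorff in \<open>auto simp: limitin_iff\<close>)

lemma convergent_of_Cauchy:
  assumes "\<And>p \<epsilon>. p \<in> P \<Longrightarrow> 0 < \<epsilon> \<Longrightarrow> \<exists>N. \<forall>k\<ge>N. \<forall>m\<ge>N. p (u k - u m) < \<epsilon>"
  shows "\<exists>l. \<forall>p\<in>P. (\<lambda>k. p (u k - l)) \<longlonglongrightarrow> 0"
proof -
  have "tvs_Cauchy T u"
    unfolding tvs_Cauchy_def
  proof (intro allI impI)
    fix U assume "openin T U \<and> 0 \<in> U"
    then obtain F \<epsilon> where F: "finite F" "F \<subseteq> P" "0 < \<epsilon>" "{y. \<forall>p\<in>F. p (y - 0) < \<epsilon>} \<subseteq> U"
      unfolding openin_iff by blast
    have "\<forall>p\<in>F. \<exists>N. \<forall>k\<ge>N. \<forall>m\<ge>N. p (u k - u m) < \<epsilon>"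
      using assms F by blast
    then obtain N where N: "\<And>p k m. p \<in> F \<Longrightarrow> N p \<le> k \<Longrightarrow> N p \<le> m \<Longrightarrow> p (u k - u m) < \<epsilon>"
      by metis
    \<comment> \<open>The sum of the thresholds serves as a common threshold for the finite family,
      and is also meaningful when the family is empty.\<close>
    have le: "p \<in> F \<Longrightarrow> N p \<le> (\<Sum>p\<in>F. N p)" for p
      using F(1) by (simp add: member_le_sum)
    show "\<exists>N. \<forall>k\<ge>N. \<forall>m\<ge>N. u k - u m \<in> U"
    proof (intro exI allI impI)
      fix k m assume km: "(\<Sum>p\<in>F. N p) \<le> k" "(\<Sum>p\<in>F. N p) \<le> m"
      have "p (u k - u m) < \<epsilon>" if "p \<in> F" for p
        using N[OF that] le[OF that] km by (meson order_trans)
      then show "u k - u m \<in> U" using F(4) by auto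
    qed
  qed
  then show ?thesis using sequentially_complete limitin_iff by blast
qed

text \<open>Absorption by every neighbourhood of \<open>0\<close> is compared with absorption by
  seminorm balls. One direction uses the unit ball of a single seminorm; the other uses that a
  neighbourhood contains a ball for finitely many seminorms.\<close>

lemma tvs_bounded_iff: "tvs_bounded scl T S \<longleftrightarrow> (\<forall>p\<in>P. \<exists>B. \<forall>x\<in>S. p x \<le> B)"
proof
  assume S: "tvs_bounded scl T S"
  show "\<forall>p\<in>P. \<exists>B. \<forall>x\<in>S. p x \<le> B"
  proof
    fix p assume p: "p \<in> P"
    obtain r where r: "r > 0" "\<forall>c. r \<le> cmod c \<longrightarrow> S \<subseteq> scl c ` {y. p (y - 0) < 1}"
      using S openin_p_ball[OF p, of 0 1] p_zero[OF p] unfolding tvs_bounded_def by force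
    have "S \<subseteq> scl (of_real r) ` {y. p (y - 0) < 1}" using r by simp
    moreover have "p (scl (of_real r) y) \<le> r" if "p y < 1" for y
      using that r(1) by (simp add: p_scale[OF p])
    ultimately show "\<exists>B. \<forall>x\<in>S. p x \<le> B" by (intro exI[of _ r]) auto
  qed
next
  assume "\<forall>p\<in>P. \<exists>B. \<forall>x\<in>S. p x \<le> B"
  then obtain B where B: "\<And>p x. p \<in> P \<Longrightarrow> x \<in> S \<Longrightarrow> p x \<le> B p" by metis
  show "tvs_bounded scl T S"
    unfolding tvs_bounded_def
  proof (intro allI impI)
    fix U assume "openin T U \<and> 0 \<in> U"
    then obtain F \<epsilon> where F: "finite F" "F \<subseteq> P" "0 < \<epsilon>" "{y. \<forall>p\<in>F. p (y - 0) < \<epsilon>} \<subseteq> U"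
      unfolding openin_iff by blast
    \<comment> \<open>The summand \<open>1\<close> makes \<open>R\<close> positive even for empty
      \<open>F\<close> and makes the bound \<open>p x < R\<close> strict.\<close>
    define R where "R = (\<Sum>p\<in>F. \<bar>B p\<bar>) + 1"
    have R: "p x < R" if "p \<in> F" "x \<in> S" for p x
    proof -
      have "p x \<le> \<bar>B p\<bar>" using B[of p x] that F by force
      also have "\<dots> \<le> (\<Sum>p\<in>F. \<bar>B p\<bar>)" using that F by (intro member_le_sum) auto
      finally show ?thesis by (simp add: R_def)
    qed
    have Rpos: "0 < R" by (simp add: R_def add_nonneg_pos sum_nonneg)
    show "\<exists>r>0. \<forall>c. r \<le> cmod c \<longrightarrow> S \<subseteq> scl c ` U"
    proof (intro exI[of _ "R / \<epsilon>"] conjI allI impI subsetI)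
      fix c x assume c: "R / \<epsilon> \<le> cmod c" and x: "x \<in> S"
      have c0: "0 < cmod c" using c Rpos F(3) by (smt (verit) divide_pos_pos)
      have "p (scl (1 / c) x) < \<epsilon>" if p: "p \<in> F" for p
      proof -
        have "p x < \<epsilon> * cmod c" using R[OF p x] c F(3) by (simp add: field_simps)
        then show ?thesis using p F c0 by (simp add: p_scale subset_iff norm_divide field_simps)
      qed
      then have "scl (1 / c) x \<in> U" using F(4) by auto
      then show "x \<in> scl c ` U" using c0 by (intro image_eqI[of _ _ "scl (1 / c) x"]) auto
    qed (use Rpos F in simp)
  qed
qed

section \<open>Integrals of simple functions against scalar weights, computed on level sets\<close>

definition wint :: "'a measure \<Rightarrow> ('a \<Rightarrow> complex) \<Rightarrow> ('a \<Rightarrow> 'x) \<Rightarrow> 'x" where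
  "wint M \<phi> s = (\<Sum>y\<in>s ` space M. scl (LINT t|M. (if s t = y then \<phi> t else 0)) y)"

lemma integrable_if_simple:
  fixes \<phi> :: "'a \<Rightarrow> 'b::{banach, second_countable_topology}"
  assumes z: "simple_function M z" and \<phi>: "integrable M \<phi>"
  shows "integrable M (\<lambda>t. if z t = w then \<phi> t else 0)"
proof -
  have "integrable M (\<lambda>t. indicator (z -` {w} \<inter> space M) t *\<^sub>R \<phi> t)"
    using simple_functionD(2)[OF z] \<phi> by (intro integrable_mult_indicator)
  then show ?thesis
    by (rule Bochner_Integration.integrable_cong[THEN iffD1, rotated 2]) auto
qed

text \<open>Each level set of \<open>h (z t)\<close> is a disjoint union of level sets of
  \<open>z\<close>, and the sum is regrouped along the fibres of \<open>h\<close>. Taking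
  \<open>z\<close> to be a pair of simple functions provides a common refinement, which gives
  additivity and the product rule below.\<close>

lemma wint_compose:
  assumes z: "simple_function M z" and \<phi>: "integrable M \<phi>"
  shows "wint M \<phi> (\<lambda>t. h (z t)) =
    (\<Sum>w\<in>z ` space M. scl (LINT t|M. (if z t = w then \<phi> t else 0)) (h w))"
proof -
  have fin: "finite (z ` space M)" using z by (simp add: simple_functionD)
  have eq: "(LINT t|M. (if h (z t) = y then \<phi> t else 0)) =
      (\<Sum>w | w \<in> z ` space M \<and> h w = y. LINT t|M. (if z t = w then \<phi> t else 0))"
      for y
  proof -
    have "(LINT t|M. (if h (z t) = y then \<phi> t else 0)) =
      (LINT t|M. (\<Sum>w | w \<in> z ` space M \<and> h w = y. if z t = w then \<phi> t else 0))"
    proof (intro Bochner_Integration.integral_cong refl)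
      fix t assume t: "t \<in> space M"
      have "finite {w \<in> z ` space M. h w = y}" using fin by simp
      from sum.delta'[OF this, of "z t" "\<lambda>_. \<phi> t"]
      show "(if h (z t) = y then \<phi> t else 0) =
          (\<Sum>w | w \<in> z ` space M \<and> h w = y. if z t = w then \<phi> t else 0)"
        using t by simp
    qed
    also have "\<dots> = (\<Sum>w | w \<in> z ` space M \<and> h w = y. LINT t|M. (if z t = w then \<phi> t else 0))"
      by (intro Bochner_Integration.integral_sum integrable_if_simple[OF z \<phi>])
    finally show ?thesis .
  qed
  have "wint M \<phi> (\<lambda>t. h (z t)) = (\<Sum>y\<in>h ` z ` space M.
      scl (LINT t|M. (if h (z t) = y then \<phi> t else 0)) y)"
    by (simp only: wint_def image_image)
  also have "\<dots> = (\<Sum>y\<in>h ` z ` space M. \<Sum>w | w \<in> z ` space M \<and> h w = y.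
      scl (LINT t|M. (if z t = w then \<phi> t else 0)) (h w))"
    unfolding eq scale_sum_left by (intro sum.cong refl) auto
  also have "\<dots> = (\<Sum>w\<in>z ` space M. scl (LINT t|M. (if z t = w then \<phi> t else 0)) (h w))"
    by (rule sum.image_gen[OF fin, symmetric])
  finally show ?thesis .
qed

lemma wint_diff:
  assumes s: "simple_function M s" "simple_function M s'" and \<phi>: "integrable M \<phi>"
  shows "wint M \<phi> (\<lambda>t. s t - s' t) = wint M \<phi> s - wint M \<phi> s'"
proof -
  have z: "simple_function M (\<lambda>t. (s t, s' t))" using s by (rule simple_function_Pair)
  show ?thesis
    using wint_compose[OF z \<phi>, of "\<lambda>w. fst w - snd w"] wint_compose[OF z \<phi>, of fst]
      wint_compose[OF z \<phi>, of snd]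
    by (simp add: scale_right_diff_distrib sum_subtractf)
qed

lemma wint_add:
  assumes "simple_function M s" "integrable M \<phi>" "integrable M \<psi>"
  shows "wint M (\<lambda>t. \<phi> t + \<psi> t) s = wint M \<phi> s + wint M \<psi> s"
proof -
  have "(LINT t|M. (if s t = y then \<phi> t + \<psi> t else 0)) =
     (LINT t|M. (if s t = y then \<phi> t else 0)) + (LINT t|M. (if s t = y then \<psi> t else 0))" for y
    by (subst Bochner_Integration.integral_add[symmetric])
      (auto intro!: integrable_if_simple assms Bochner_Integration.integral_cong)
  then show ?thesis by (simp add: wint_def scale_left_distrib sum.distrib)
qed

lemma wint_scale: "wint M (\<lambda>t. c * \<phi> t) s = scl c (wint M \<phi> s)"
proof -
  have "(LINT t|M. (if s t = y then c * \<phi> t else 0)) = c * (LINT t|M. (if s t = y then \<phi> t else 0))" for y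
    unfolding integral_mult_right_zero[symmetric]
    by (intro Bochner_Integration.integral_cong) auto
  then show ?thesis by (simp add: wint_def scale_sum_right)
qed

lemma wint_cong: "(\<And>t. t \<in> space M \<Longrightarrow> \<phi> t = \<psi> t) \<Longrightarrow> wint M \<phi> s = wint M \<psi> s"
  unfolding wint_def
  by (intro sum.cong arg_cong2[of _ _ _ _ scl] Bochner_Integration.integral_cong) auto

lemma integrable_simple:
  fixes g :: "'a \<Rightarrow> 'b::{banach, second_countable_topology}"
  assumes "finite_measure M" "simple_function M g" shows "integrable M g"
  using assms by (intro integrable_simple_function)
    (auto simp: finite_measure.emeasure_finite)

text \<open>On each level set the integral of \<open>\<phi>\<close> is at most \<open>B\<close>
  times the measure of that set; weighting by \<open>p y\<close> and summing over the values
  reassembles the integral of \<open>p (s t)\<close>.\<close>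

lemma wint_bound:
  assumes p: "p \<in> P" and M: "finite_measure M" and s: "simple_function M s"
    and \<phi>: "integrable M \<phi>" and B: "\<And>t. t \<in> space M \<Longrightarrow> cmod (\<phi> t) \<le> B"
  shows "p (wint M \<phi> s) \<le> B * (LINT t|M. p (s t))"
proof -
  have fin: "finite (s ` space M)" using s by (simp add: simple_functionD)
  have int: "integrable M (\<lambda>t. if s t = y then c else 0)" for y and c :: real
    using integrable_if_simple[OF s, of "\<lambda>_. c"] finite_measure.integrable_const[OF M] by auto
  have "p (wint M \<phi> s) \<le> (\<Sum>y\<in>s ` space M. cmod (LINT t|M. (if s t = y then \<phi> t else 0)) * p y)"
    unfolding wint_def using p_sum[OF p] by (auto simp: p_scale[OF p, symmetric])
  also have "\<dots> \<le> (\<Sum>y\<in>s ` space M. (LINT t|M. (if s t = y then B else 0)) * p y)"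
  proof (intro sum_mono mult_right_mono p_nonneg[OF p])
    show "cmod (LINT t|M. (if s t = y then \<phi> t else 0)) \<le> (LINT t|M. (if s t = y then B else 0))" for y
      by (rule order.trans[OF integral_norm_bound], rule Bochner_Integration.integral_mono)
        (auto simp: B intro!: integrable_if_simple[OF s \<phi>] int)
  qed
  also have "\<dots> = (LINT t|M. (\<Sum>y\<in>s ` space M. (if s t = y then B else 0) * p y))"
    using int by simp
  also have "\<dots> = (LINT t|M. B * p (s t))"
    using fin by (intro Bochner_Integration.integral_cong) (auto simp: if_distrib[of "\<lambda>a. a * _"] cong: if_cong)
  finally show ?thesis by simp
qed

text \<open>On a level set of the pair \<open>(\<psi> t, s t)\<close> the weight is constant, so it
  may be moved from the weight into the value.\<close>

lemma wint_scale_simple: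
  assumes M: "finite_measure M" and \<psi>: "simple_function M \<psi>" and s: "simple_function M s"
  shows "wint M (\<lambda>_. 1) (\<lambda>t. scl (\<psi> t) (s t)) = wint M \<psi> s"
proof -
  have z: "simple_function M (\<lambda>t. (\<psi> t, s t))" using \<psi> s by (rule simple_function_Pair)
  have "(LINT t|M. (if (\<psi> t, s t) = w then \<psi> t else 0)) =
      fst w * (LINT t|M. (if (\<psi> t, s t) = w then 1 else 0))" for w
    unfolding integral_mult_right_zero[symmetric]
    by (intro Bochner_Integration.integral_cong) auto
  then show ?thesis
    using wint_compose[OF z integrable_simple[OF M \<psi>], of snd]
      wint_compose[OF z finite_measure.integrable_const[OF M], of 1 "\<lambda>w. scl (fst w) (snd w)"]
    by (simp add: mult.commute)
qed

lemma simple_integral_eq_wint: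
  assumes K: "compact K" and s: "simple_function (lebesgue_on K) s"
  shows "simple_integral_on scl K s = wint (lebesgue_on K) (\<lambda>_. 1) s"
proof -
  have "complex_of_real (measure lebesgue (s -` {y} \<inter> K)) =
      (LINT t|lebesgue_on K. (if s t = y then 1 else 0))" for y
  proof -
    have KL: "K \<in> sets lebesgue" using K by (simp add: compact_imp_closed lmeasurable_compact fmeasurableD)
    have "(LINT t|lebesgue_on K. (if s t = y then 1 else 0)) =
        (LINT t|lebesgue_on K. complex_of_real (indicator (s -` {y} \<inter> K) t))"
      by (intro Bochner_Integration.integral_cong) (auto simp: indicator_def)
    also have "\<dots> = complex_of_real (measure (lebesgue_on K) (s -` {y} \<inter> K))"
      by (subst integral_complex_of_real) simp
    also have "\<dots> = complex_of_real (measure lebesgue (s -` {y} \<inter> K))"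
      using KL by (subst measure_restrict_space) auto
    finally show ?thesis by simp
  qed
  then show ?thesis by (simp add: simple_integral_on_def wint_def)
qed

text \<open>Values that \<open>s\<close> takes only on \<open>K - K'\<close> contribute zero on the
  right, so both sums may run over the values on all of \<open>K\<close>.\<close>

lemma wint_restrict:
  assumes K: "K \<in> sets lebesgue" "K' \<in> sets lebesgue" "K' \<subseteq> K"
    and s: "simple_function (lebesgue_on K) s"
  shows "wint (lebesgue_on K') \<phi> s = wint (lebesgue_on K) (\<lambda>t. indicator K' t * \<phi> t) s"
proof -
  have eq: "(LINT t|lebesgue_on K'. (if s t = y then \<phi> t else 0)) =
     (LINT t|lebesgue_on K. (if s t = y then indicator K' t * \<phi> t else 0))" for y
    using K by (subst (1 2) integral_restrict_space)
      (auto intro!: Bochner_Integration.integral_cong simp: indicator_def)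
  have "scl (LINT t|lebesgue_on K. (if s t = y then indicator K' t * \<phi> t else 0)) y = 0"
    if "y \<notin> s ` K'" for y
  proof -
    have "(LINT t|lebesgue_on K. (if s t = y then indicator K' t * \<phi> t else 0)) =
        (LINT t|lebesgue_on K. 0)"
      using that by (intro Bochner_Integration.integral_cong) (auto simp: indicator_def)
    then show ?thesis by simp
  qed
  then show ?thesis
    unfolding wint_def using K simple_functionD(1)[OF s]
    by (auto simp: eq intro!: sum.mono_neutral_left)
qed

section \<open>Independence of the integral from the approximating sequence\<close>

lemma integrable_p_simple:
  assumes "finite_measure M" "simple_function M s"
  shows "integrable M (\<lambda>t. p (s t) :: real)"
  by (rule integrable_simple[OF assms(1) simple_function_compose1[OF assms(2)]])

lemma finite_measure_compact: "compact K \<Longrightarrow> finite_measure (lebesgue_on K)"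
  by (simp add: finite_measure_lebesgue_on lmeasurable_compact)

lemma sets_compact: "compact K \<Longrightarrow> K \<in> sets lebesgue"
  by (simp add: lmeasurable_compact fmeasurableD)

lemma approx_simple_D:
  assumes "approx_simple T P K f s"
  shows "simple_function (lebesgue_on K) (s k)"
    and "AE t in lebesgue_on K. \<forall>p\<in>P. (\<lambda>k. p (s k t - f t)) \<longlonglongrightarrow> 0"
    and "p \<in> P \<Longrightarrow> 0 < \<epsilon> \<Longrightarrow>
      \<exists>k0. \<forall>k\<ge>k0. \<forall>m\<ge>k0. (LINT t|lebesgue_on K. p (s k t - s m t)) \<le> \<epsilon>"
  using assms unfolding approx_simple_def limitin_iff by auto

text \<open>The functions \<open>p (s k t - s' k t)\<close> form an L1-Cauchy sequence that tends to
  \<open>0\<close> almost everywhere, so Fatou's lemma in the second index gives convergence to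
  \<open>0\<close> in L1. All functions integrated are built from simple ones, which keeps them
  integrable.\<close>

lemma approx_simple_diff_L1:
  assumes K: "compact K" and s: "approx_simple T P K f s" "approx_simple T P K f s'" and p: "p \<in> P"
  shows "(\<lambda>k. LINT t|lebesgue_on K. p (s k t - s' k t)) \<longlonglongrightarrow> 0"
proof (rule LIMSEQ_I)
  fix r :: real assume r: "0 < r"
  define M where "M = lebesgue_on K"
  define d where "d k t = p (s k t - s' k t)" for k t
  have fin: "finite_measure M" unfolding M_def by (rule finite_measure_compact[OF K])
  have simple: "simple_function M (s k)" "simple_function M (s' k)" for k
    using approx_simple_D(1) s by (auto simp: M_def)
  have d0: "0 \<le> d k t" for k t by (simp add: d_def p_nonneg[OF p])
  have dint: "integrable M (d k)" for k
    unfolding d_def by (intro integrable_p_simple fin simple_function_diff simple)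
  have pint: "integrable M (\<lambda>t. p (s k t - s m t))" "integrable M (\<lambda>t. p (s' k t - s' m t))" for k m
    by (intro integrable_p_simple fin simple_function_diff simple)+
  obtain k1 where k1: "\<And>k m. k1 \<le> k \<Longrightarrow> k1 \<le> m \<Longrightarrow> (LINT t|M. p (s k t - s m t)) \<le> r / 4"
    using approx_simple_D(3)[OF s(1) p, of "r / 4"] r unfolding M_def by auto
  obtain k2 where k2: "\<And>k m. k2 \<le> k \<Longrightarrow> k2 \<le> m \<Longrightarrow> (LINT t|M. p (s' k t - s' m t)) \<le> r / 4"
    using approx_simple_D(3)[OF s(2) p, of "r / 4"] r unfolding M_def by auto
  have diff: "\<bar>d k t - d m t\<bar> \<le> p (s k t - s m t) + p (s' k t - s' m t)" for k m t
  proof -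
    have "\<bar>d k t - d m t\<bar> \<le> p ((s k t - s m t) - (s' k t - s' m t))"
      using p_abs_diff_le[OF p, of "s k t - s' k t" "s m t - s' m t"] by (simp add: d_def algebra_simps)
    also have "\<dots> \<le> p (s k t - s m t) + p (s' k t - s' m t)"
      using p_triangle_diff[OF p, of "s k t - s m t" "s' k t - s' m t" 0] p_triangle[OF p, of "s k t - s m t" "- (s' k t - s' m t)"]
      by (simp add: p_commute[OF p, of "s' m t"])
    finally show ?thesis .
  qed
  have lim: "AE t in M. (\<lambda>m. d m t) \<longlonglongrightarrow> 0"
    using approx_simple_D(2)[OF s(1)] approx_simple_D(2)[OF s(2)] unfolding M_def
  proof eventually_elim
    case (elim t)
    have "(\<lambda>m. p (s m t - f t) + p (s' m t - f t)) \<longlonglongrightarrow> 0"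
      using elim p by (auto intro: tendsto_add_zero)
    moreover have "norm (d m t) \<le> p (s m t - f t) + p (s' m t - f t)" for m
      using p_triangle_diff[OF p, of "s m t" "s' m t" "f t"] p_commute[OF p, of "f t"] d0[of m t]
      by (simp add: d_def)
    ultimately show ?case by (rule Lim_null_comparison[OF always_eventually[OF allI], rotated])
  qed
  show "\<exists>k0. \<forall>k\<ge>k0. norm ((LINT t|lebesgue_on K. p (s k t - s' k t)) - 0) < r"
  proof (intro exI allI impI)
    fix k assume k: "max k1 k2 \<le> k"
    have "ennreal (LINT t|M. d k t) = (\<integral>\<^sup>+t. ennreal (d k t) \<partial>M)"
      by (rule nn_integral_eq_integral[symmetric]) (use dint d0 in auto)
    \<comment> \<open>Since \<open>d m t\<close> tends to \<open>0\<close> for almost every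
      \<open>t\<close>, the value \<open>d k t\<close> is the limit of
      \<open>\<bar>d k t - d m t\<bar>\<close> in \<open>m\<close>; this is the form to which
      Fatou's lemma applies.\<close>
    also have "\<dots> = (\<integral>\<^sup>+t. liminf (\<lambda>m. ennreal \<bar>d k t - d m t\<bar>) \<partial>M)"
    proof (rule nn_integral_cong_AE)
      show "AE t in M. ennreal (d k t) = liminf (\<lambda>m. ennreal \<bar>d k t - d m t\<bar>)"
        using lim
      proof eventually_elim
        case (elim t)
        have "(\<lambda>m. \<bar>d k t - d m t\<bar>) \<longlonglongrightarrow> \<bar>d k t - 0\<bar>"
          by (intro tendsto_intros elim)
        then have "(\<lambda>m. ennreal \<bar>d k t - d m t\<bar>) \<longlonglongrightarrow> ennreal (d k t)"
          using d0[of k t] by (intro tendsto_ennrealI) simp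
        then show ?case by (simp add: lim_imp_Liminf)
      qed
    qed
    also have "\<dots> \<le> liminf (\<lambda>m. \<integral>\<^sup>+t. ennreal \<bar>d k t - d m t\<bar> \<partial>M)"
      by (rule nn_integral_liminf) (use dint in measurable)
    also have "\<dots> \<le> limsup (\<lambda>m. \<integral>\<^sup>+t. ennreal \<bar>d k t - d m t\<bar> \<partial>M)"
      by (rule Liminf_le_Limsup) simp
    also have "\<dots> \<le> ennreal (r / 2)"
    proof (rule Limsup_bounded, rule eventually_sequentiallyI[of "max k1 k2"])
      fix m assume m: "max k1 k2 \<le> m"
      have "(\<integral>\<^sup>+t. ennreal \<bar>d k t - d m t\<bar> \<partial>M) = ennreal (LINT t|M. \<bar>d k t - d m t\<bar>)"
        by (rule nn_integral_eq_integral) (use dint in auto)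
      also have "(LINT t|M. \<bar>d k t - d m t\<bar>) \<le> (LINT t|M. p (s k t - s m t) + p (s' k t - s' m t))"
        using diff dint pint by (intro Bochner_Integration.integral_mono) auto
      also have "\<dots> = (LINT t|M. p (s k t - s m t)) + (LINT t|M. p (s' k t - s' m t))"
        by (rule Bochner_Integration.integral_add[OF pint])
      also have "\<dots> \<le> r / 2" using k1[of k m] k2[of k m] k m by simp
      finally show "(\<integral>\<^sup>+t. ennreal \<bar>d k t - d m t\<bar> \<partial>M) \<le> ennreal (r / 2)"
        by (simp add: ennreal_leI)
    qed
    finally have "(LINT t|M. d k t) \<le> r / 2" using r by (simp add: ennreal_le_iff)
    moreover have "0 \<le> (LINT t|M. d k t)" by (simp add: d0)
    ultimately show "norm ((LINT t|lebesgue_on K. p (s k t - s' k t)) - 0) < r"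
      using r unfolding M_def d_def by simp
  qed
qed

text \<open>Makes the definite description in \<open>integral_K\<close> usable: any other
  approximating sequence has simple integrals at L1-distance tending to \<open>0\<close>, hence the
  same limit.\<close>

lemma integral_K_eqI:
  assumes K: "compact K" and s: "approx_simple T P K f s"
    and l: "\<And>p. p \<in> P \<Longrightarrow> (\<lambda>k. p (simple_integral_on scl K (s k) - l)) \<longlonglongrightarrow> 0"
  shows "integral_K scl T P K f = l"
  unfolding integral_K_def
proof (rule the_equality)
  show "\<exists>s. approx_simple T P K f s \<and> limitin T (\<lambda>k. simple_integral_on scl K (s k)) l sequentially"
    using s l limitin_iff by blast
next
  fix l' assume "\<exists>s. approx_simple T P K f s \<and> limitin T (\<lambda>k. simple_integral_on scl K (s k)) l' sequentially"
  then obtain s' where s': "approx_simple T P K f s'"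
    and l': "\<And>p. p \<in> P \<Longrightarrow> (\<lambda>k. p (simple_integral_on scl K (s' k) - l')) \<longlonglongrightarrow> 0"
    by (auto simp: limitin_iff)
  have fin: "finite_measure (lebesgue_on K)" by (rule finite_measure_compact[OF K])
  have simple: "simple_function (lebesgue_on K) (s k)" "simple_function (lebesgue_on K) (s' k)" for k
    using approx_simple_D(1) s s' by auto
  show "l' = l"
  proof (rule limit_unique)
    fix p assume p: "p \<in> P"
    show "(\<lambda>k. p (simple_integral_on scl K (s' k) - l')) \<longlonglongrightarrow> 0" by (rule l'[OF p])
    have bd: "p (simple_integral_on scl K (s' k) - simple_integral_on scl K (s k)) \<le>
        1 * (LINT t|lebesgue_on K. p (s' k t - s k t))" for k
      unfolding simple_integral_eq_wint[OF K simple(1)] simple_integral_eq_wint[OF K simple(2)]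
        wint_diff[OF simple(2,1) finite_measure.integrable_const[OF fin], symmetric]
      by (intro wint_bound p fin simple_function_diff simple finite_measure.integrable_const) simp
    have "norm (p (simple_integral_on scl K (s' k) - l)) \<le>
        (LINT t|lebesgue_on K. p (s' k t - s k t)) + p (simple_integral_on scl K (s k) - l)" for k
      using p_triangle_diff[OF p, of "simple_integral_on scl K (s' k)" l "simple_integral_on scl K (s k)"]
        bd[of k] p_nonneg[OF p, of "simple_integral_on scl K (s' k) - l"]
      by simp
    then show "(\<lambda>k. p (simple_integral_on scl K (s' k) - l)) \<longlonglongrightarrow> 0"
      by (rule Lim_null_comparison[OF always_eventually[OF allI]])
        (intro tendsto_add_zero approx_simple_diff_L1[OF K s' s p] l[OF p])
  qed
qed

section \<open>Multiplication of integrable functions by bounded scalar weights\<close>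

definition bounded_weight :: "'a measure \<Rightarrow> ('a \<Rightarrow> complex) \<Rightarrow> bool" where
  "bounded_weight M \<phi> \<longleftrightarrow> \<phi> \<in> borel_measurable M \<and> (\<exists>B. \<forall>t\<in>space M. cmod (\<phi> t) \<le> B)"

lemma bounded_weight_integrable:
  assumes "finite_measure M" "bounded_weight M \<phi>" shows "integrable M \<phi>"
  using assms unfolding bounded_weight_def
  by (auto intro!: finite_measure.integrable_const_bound AE_I2)

lemma bounded_weight_add:
  assumes "bounded_weight M \<phi>" "bounded_weight M \<psi>"
  shows "bounded_weight M (\<lambda>t. \<phi> t + \<psi> t)"
proof -
  obtain B C where "\<forall>t\<in>space M. cmod (\<phi> t) \<le> B" "\<forall>t\<in>space M. cmod (\<psi> t) \<le> C"
    using assms unfolding bounded_weight_def by blast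
  then have "\<forall>t\<in>space M. cmod (\<phi> t + \<psi> t) \<le> B + C"
    by (meson add_mono norm_triangle_le)
  then show ?thesis using assms unfolding bounded_weight_def by auto
qed

lemma bounded_weight_mult:
  assumes "bounded_weight M \<phi>" "bounded_weight M \<psi>"
  shows "bounded_weight M (\<lambda>t. \<phi> t * \<psi> t)"
proof -
  obtain B C where "\<forall>t\<in>space M. cmod (\<phi> t) \<le> B" "\<forall>t\<in>space M. cmod (\<psi> t) \<le> C"
    using assms unfolding bounded_weight_def by blast
  then have "\<forall>t\<in>space M. cmod (\<phi> t * \<psi> t) \<le> B * C"
    unfolding norm_mult by (metis mult_mono' norm_ge_zero)
  then show ?thesis using assms unfolding bounded_weight_def by auto
qed

lemma bounded_weight_const: "bounded_weight M (\<lambda>_. c)"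
  unfolding bounded_weight_def by auto

lemma bounded_weight_prod:
  assumes "\<And>j. j \<in> A \<Longrightarrow> bounded_weight M (h j)"
  shows "bounded_weight M (\<lambda>t. \<Prod>j\<in>A. h j t)"
  using assms
  by (induction A rule: infinite_finite_induct) (auto intro!: bounded_weight_const bounded_weight_mult)

lemma bounded_weight_sum:
  assumes "\<And>j. j \<in> A \<Longrightarrow> bounded_weight M (h j)"
  shows "bounded_weight M (\<lambda>t. \<Sum>j\<in>A. h j t)"
  using assms
  by (induction A rule: infinite_finite_induct) (auto intro!: bounded_weight_const bounded_weight_add)

lemma bounded_weight_diff:
  assumes "bounded_weight M \<phi>" "bounded_weight M \<psi>"
  shows "bounded_weight M (\<lambda>t. \<phi> t - \<psi> t)"
  using bounded_weight_add[OF assms(1) bounded_weight_mult[OF bounded_weight_const[of M "-1"] assms(2)]]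
  by simp

text \<open>Real and imaginary part are rounded down to multiples of \<open>e / 2\<close>. Each
  contributes an error of at most \<open>e / 2\<close>, and boundedness of the weight leaves
  finitely many values.\<close>

lemma bounded_weight_simple_approx:
  assumes \<phi>: "bounded_weight M \<phi>" and e: "0 < e"
  shows "\<exists>\<psi>. simple_function M \<psi> \<and> (\<forall>t\<in>space M. cmod (\<phi> t - \<psi> t) \<le> e)"
proof -
  obtain B where B: "\<And>t. t \<in> space M \<Longrightarrow> cmod (\<phi> t) \<le> B"
    using \<phi> unfolding bounded_weight_def by blast
  have [measurable]: "\<phi> \<in> borel_measurable M" using \<phi> unfolding bounded_weight_def by blast
  define d where "d = e / 2"
  have d: "0 < d" using e by (simp add: d_def)
  define fl where "fl x = d * of_int \<lfloor>x / d\<rfloor>" for x :: real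
  define \<psi> where "\<psi> t = Complex (fl (Re (\<phi> t))) (fl (Im (\<phi> t)))" for t
  have fl: "\<bar>x - fl x\<bar> \<le> d" for x
  proof -
    have "x - fl x = d * (x / d - of_int \<lfloor>x / d\<rfloor>)" using d by (simp add: fl_def field_simps)
    moreover have "\<bar>x / d - of_int \<lfloor>x / d\<rfloor>\<bar> \<le> 1" by linarith
    ultimately show ?thesis using d by (simp add: abs_mult mult_left_le)
  qed
  have "cmod (\<phi> t - \<psi> t) \<le> e" for t
    using cmod_le[of "\<phi> t - \<psi> t"] fl[of "Re (\<phi> t)"] fl[of "Im (\<phi> t)"] by (simp add: \<psi>_def d_def)
  moreover have "simple_function M \<psi>"
    unfolding simple_function_def
  proof
    define A where "A = (\<lambda>k. d * of_int k) ` {\<lfloor>- B / d\<rfloor>..\<lfloor>B / d\<rfloor>}"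
    have "fl x \<in> A" if "\<bar>x\<bar> \<le> B" for x
      using that d unfolding fl_def A_def
      by (intro imageI) (auto intro!: floor_mono simp: field_simps)
    moreover have "\<bar>Re (\<phi> t)\<bar> \<le> B" "\<bar>Im (\<phi> t)\<bar> \<le> B" if "t \<in> space M" for t
      using B[OF that] abs_Re_le_cmod abs_Im_le_cmod order.trans by blast+
    ultimately have "\<psi> ` space M \<subseteq> (\<lambda>(a, b). Complex a b) ` (A \<times> A)"
      by (auto simp: \<psi>_def)
    then show "finite (\<psi> ` space M)"
      by (rule finite_subset) (simp add: A_def)
    have "(\<lambda>t. of_real (fl (Re (\<phi> t))) + \<i> * of_real (fl (Im (\<phi> t)))) \<in> borel_measurable M"
      unfolding fl_def by measurable
    then have [measurable]: "\<psi> \<in> borel_measurable M" by (simp add: \<psi>_def[abs_def] Complex_eq)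
    show "\<forall>y\<in>\<psi> ` space M. \<psi> -` {y} \<inter> space M \<in> sets M"
      by (intro ballI measurable_sets[of _ _ borel]) auto
  qed
  ultimately show ?thesis by blast
qed

text \<open>From the Cauchy threshold \<open>k0\<close> on, every term is within L1-distance
  \<open>1\<close> of the fixed term \<open>s k0\<close>.\<close>

lemma approx_simple_L1_bounded:
  assumes K: "compact K" and s: "approx_simple T P K f s" and p: "p \<in> P"
  obtains L k0 where "0 \<le> L" "\<And>k. k0 \<le> k \<Longrightarrow> (LINT t|lebesgue_on K. p (s k t)) \<le> L"
proof -
  have fin: "finite_measure (lebesgue_on K)" by (rule finite_measure_compact[OF K])
  have simple: "simple_function (lebesgue_on K) (s k)" for k
    by (rule approx_simple_D(1)[OF s])
  obtain k0 where k0: "\<And>k m. k0 \<le> k \<Longrightarrow> k0 \<le> m \<Longrightarrow> (LINT t|lebesgue_on K. p (s k t - s m t)) \<le> 1"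
    using approx_simple_D(3)[OF s p, of 1] by auto
  have int: "integrable (lebesgue_on K) (\<lambda>t. p (s k t))" "integrable (lebesgue_on K) (\<lambda>t. p (s k t - s m t))" for k m
    by (intro integrable_p_simple fin simple_function_diff simple)+
  have "(LINT t|lebesgue_on K. p (s k t)) \<le> 1 + (LINT t|lebesgue_on K. p (s k0 t))" if "k0 \<le> k" for k
  proof -
    have "(LINT t|lebesgue_on K. p (s k t)) \<le> (LINT t|lebesgue_on K. p (s k t - s k0 t) + p (s k0 t))"
      using int p_le_diff[OF p] by (intro Bochner_Integration.integral_mono Bochner_Integration.integrable_add) auto
    also have "\<dots> = (LINT t|lebesgue_on K. p (s k t - s k0 t)) + (LINT t|lebesgue_on K. p (s k0 t))"
      by (rule Bochner_Integration.integral_add[OF int(2) int(1)])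
    finally show ?thesis using k0[OF that order.refl] by simp
  qed
  moreover have "0 \<le> (LINT t|lebesgue_on K. p (s k0 t))" by (simp add: p_nonneg[OF p])
  ultimately show ?thesis by (intro that[of "1 + (LINT t|lebesgue_on K. p (s k0 t))" k0]) auto
qed

text \<open>A bounded weight carries the L1-Cauchy property of the simple functions over to the
  weighted integrals, up to a constant factor; sequential completeness then supplies the
  limit.\<close>

lemma wint_convergent:
  assumes K: "compact K" and s: "approx_simple T P K f s" and \<phi>: "bounded_weight (lebesgue_on K) \<phi>"
  shows "\<exists>l. \<forall>p\<in>P. (\<lambda>k. p (wint (lebesgue_on K) \<phi> (s k) - l)) \<longlonglongrightarrow> 0"
proof (rule convergent_of_Cauchy)
  fix p and \<epsilon> :: real assume p: "p \<in> P" and e: "0 < \<epsilon>"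
  have fin: "finite_measure (lebesgue_on K)" by (rule finite_measure_compact[OF K])
  have simple: "simple_function (lebesgue_on K) (s k)" for k
    by (rule approx_simple_D(1)[OF s])
  obtain B where B: "\<And>t. t \<in> space (lebesgue_on K) \<Longrightarrow> cmod (\<phi> t) \<le> B"
    using \<phi> unfolding bounded_weight_def by blast
  define C where "C = \<bar>B\<bar> + 1"
  have C: "0 < C" "\<And>t. t \<in> space (lebesgue_on K) \<Longrightarrow> cmod (\<phi> t) \<le> C"
    using B by (fastforce simp: C_def)+
  obtain k0 where k0: "\<And>k m. k0 \<le> k \<Longrightarrow> k0 \<le> m \<Longrightarrow>
      (LINT t|lebesgue_on K. p (s k t - s m t)) \<le> \<epsilon> / (2 * C)"
    using approx_simple_D(3)[OF s p, of "\<epsilon> / (2 * C)"] C(1) e by auto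
  show "\<exists>N. \<forall>k\<ge>N. \<forall>m\<ge>N. p (wint (lebesgue_on K) \<phi> (s k) - wint (lebesgue_on K) \<phi> (s m)) < \<epsilon>"
  proof (intro exI allI impI)
    fix k m assume km: "k0 \<le> k" "k0 \<le> m"
    have "p (wint (lebesgue_on K) \<phi> (s k) - wint (lebesgue_on K) \<phi> (s m)) \<le>
        C * (LINT t|lebesgue_on K. p (s k t - s m t))"
      unfolding wint_diff[OF simple simple bounded_weight_integrable[OF fin \<phi>], symmetric]
      by (intro wint_bound p fin simple_function_diff simple bounded_weight_integrable \<phi> C)
    also have "\<dots> \<le> C * (\<epsilon> / (2 * C))" using k0[OF km] C by (intro mult_left_mono) auto
    also have "\<dots> < \<epsilon>" using C(1) e by simp
    finally show "p (wint (lebesgue_on K) \<phi> (s k) - wint (lebesgue_on K) \<phi> (s m)) < \<epsilon>" .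
  qed
qed

lemma bounded_weight_indicator:
  assumes "K' \<in> sets lebesgue" shows "bounded_weight (lebesgue_on K) (indicator K')"
proof -
  have "(indicator K' :: _ \<Rightarrow> complex) \<in> borel_measurable (lebesgue_on K)"
    using assms by (intro measurable_restrict_space1 borel_measurable_indicator)
  then show ?thesis
    unfolding bounded_weight_def by (auto intro!: exI[of _ 1] simp: indicator_def)
qed

lemma integral_restrict_le:
  fixes u :: "real ^ 'n \<Rightarrow> real"
  assumes K: "K \<in> sets lebesgue" "K' \<in> sets lebesgue" "K' \<subseteq> K"
    and u: "integrable (lebesgue_on K) u" "\<And>t. 0 \<le> u t"
  shows "(LINT t|lebesgue_on K'. u t) \<le> (LINT t|lebesgue_on K. u t)"
proof -
  have "(LINT t|lebesgue_on K'. u t) = (LINT t|lebesgue_on K. indicator K' t * u t)"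
    using K by (subst (1 2) integral_restrict_space)
      (auto intro!: Bochner_Integration.integral_cong simp: indicator_def)
  also have "\<dots> \<le> (LINT t|lebesgue_on K. u t)"
    by (rule integral_mono') (use u in \<open>auto simp: indicator_def\<close>)
  finally show ?thesis .
qed

lemma simple_function_subset:
  assumes K: "K \<in> sets lebesgue" "K' \<in> sets lebesgue" "K' \<subseteq> K"
    and g: "simple_function (lebesgue_on K) g"
  shows "simple_function (lebesgue_on K') g"
  unfolding simple_function_def
proof
  show "finite (g ` space (lebesgue_on K'))"
    using simple_functionD(1)[OF g] K(3) finite_subset[OF image_mono[OF K(3), of g]] by simp
  show "\<forall>y\<in>g ` space (lebesgue_on K'). g -` {y} \<inter> space (lebesgue_on K') \<in> sets (lebesgue_on K')"
  proof
    fix y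
    have "g -` {y} \<inter> K \<in> sets (lebesgue_on K)"
      using simple_functionD(2)[OF g, of "{y}"] by simp
    then have "g -` {y} \<inter> K \<in> sets lebesgue"
      using K by (simp add: sets_restrict_space_iff)
    then have "(g -` {y} \<inter> K) \<inter> K' \<in> sets lebesgue" using K by blast
    moreover have "(g -` {y} \<inter> K) \<inter> K' = g -` {y} \<inter> K'" using K by blast
    ultimately show "g -` {y} \<inter> space (lebesgue_on K') \<in> sets (lebesgue_on K')"
      using K by (simp add: sets_restrict_space_iff)
  qed
qed

text \<open>Links the abstract integral with weighted integrals of one fixed sequence. If simple
  \<open>\<psi> k\<close> approximate \<open>\<phi>\<close> uniformly, then the products of
  \<open>\<psi> k\<close> and \<open>s k\<close> approximate the product of \<open>\<phi>\<close>
  and \<open>f\<close> on \<open>K'\<close>. Since the \<open>s k\<close> are eventually bounded in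
  L1, replacing \<open>\<psi> k\<close> by \<open>\<phi>\<close> does not change the limit of the
  integrals.\<close>

lemma integral_K_weighted:
  assumes K: "compact K" "compact K'" "K' \<subseteq> K" and s: "approx_simple T P K f s"
    and \<phi>: "bounded_weight (lebesgue_on K) \<phi>"
    and l: "\<And>p. p \<in> P \<Longrightarrow>
      (\<lambda>k. p (wint (lebesgue_on K) (\<lambda>t. indicator K' t * \<phi> t) (s k) - l)) \<longlonglongrightarrow> 0"
  shows "integral_K scl T P K' (\<lambda>t. scl (\<phi> t) (f t)) = l"
proof -
  define M where "M = lebesgue_on K"
  have KL: "K \<in> sets lebesgue" "K' \<in> sets lebesgue" using K sets_compact by auto
  have fin: "finite_measure M" unfolding M_def by (rule finite_measure_compact[OF K(1)])
  have simple: "simple_function M (s k)" for k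
    unfolding M_def by (rule approx_simple_D(1)[OF s])
  have spaceM: "space M = K" by (simp add: M_def)
  have \<phi>M: "bounded_weight M \<phi>" using \<phi> by (simp add: M_def)
  obtain B where B: "\<And>t. t \<in> K \<Longrightarrow> cmod (\<phi> t) \<le> B"
    using \<phi>M unfolding bounded_weight_def spaceM by blast
  define C where "C = \<bar>B\<bar> + 1"
  have C: "0 < C" "\<And>t. t \<in> K \<Longrightarrow> cmod (\<phi> t) \<le> C"
    using B by (fastforce simp: C_def)+
  have "\<exists>\<psi>. simple_function M \<psi> \<and> (\<forall>t\<in>K. cmod (\<phi> t - \<psi> t) \<le> 1 / real (Suc k))" for k
    using bounded_weight_simple_approx[OF \<phi>M, of "1 / real (Suc k)"] by (simp add: spaceM)
  then obtain \<psi> where \<psi>: "\<And>k. simple_function M (\<psi> k)"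
    and \<psi>\<phi>: "\<And>k t. t \<in> K \<Longrightarrow> cmod (\<phi> t - \<psi> k t) \<le> 1 / real (Suc k)"
    by metis
  define s' where "s' k t = scl (\<psi> k t) (s k t)" for k t
  have s'M: "simple_function M (s' k)" for k
    using simple_function_compose1[OF simple_function_Pair[OF \<psi>[of k] simple[of k]], of "\<lambda>(a, b). scl a b"]
    by (simp add: s'_def[abs_def])
  have s'K': "simple_function (lebesgue_on K') (s' k)" for k
    by (rule simple_function_subset[OF KL K(3) s'M[unfolded M_def]])
  have inv: "(\<lambda>k. 1 / real (Suc k)) \<longlonglongrightarrow> 0" by (rule lim_inverse_n'[THEN LIMSEQ_Suc])
  have approx: "approx_simple T P K' (\<lambda>t. scl (\<phi> t) (f t)) s'"
    unfolding approx_simple_def limitin_iff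
  proof (intro conjI allI impI ballI s'K')
    have "AE t in M. \<forall>p\<in>P. (\<lambda>k. p (s' k t - scl (\<phi> t) (f t))) \<longlonglongrightarrow> 0"
      using approx_simple_D(2)[OF s, folded M_def] AE_space
    proof eventually_elim
      case (elim t)
      then have t: "t \<in> K" by (simp add: spaceM)
      show ?case
      proof
        fix p assume p: "p \<in> P"
        have lim: "(\<lambda>k. p (s k t - f t)) \<longlonglongrightarrow> 0" using elim p by blast
        have "(\<lambda>k. 1 / real (Suc k) * (p (s k t - f t) + p (f t)) + C * p (s k t - f t)) \<longlonglongrightarrow> 0 * (0 + p (f t)) + C * 0"
          by (intro tendsto_intros inv lim)
        then have "(\<lambda>k. 1 / real (Suc k) * (p (s k t - f t) + p (f t)) + C * p (s k t - f t)) \<longlonglongrightarrow> 0"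
          by simp
        moreover have "norm (p (s' k t - scl (\<phi> t) (f t))) \<le>
            1 / real (Suc k) * (p (s k t - f t) + p (f t)) + C * p (s k t - f t)" for k
        proof -
          \<comment> \<open>The error is split into that of the weight, multiplied by the eventually
            bounded \<open>p (s k t)\<close>, and that of the function, multiplied by the bounded
            weight.\<close>
          have "s' k t - scl (\<phi> t) (f t) = scl (\<psi> k t - \<phi> t) (s k t) + scl (\<phi> t) (s k t - f t)"
            by (simp add: s'_def scale_left_diff_distrib scale_right_diff_distrib)
          then have "p (s' k t - scl (\<phi> t) (f t)) \<le> cmod (\<phi> t - \<psi> k t) * p (s k t) + cmod (\<phi> t) * p (s k t - f t)"
            using p_triangle[OF p, of "scl (\<psi> k t - \<phi> t) (s k t)" "scl (\<phi> t) (s k t - f t)"]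
            by (simp add: p_scale[OF p] norm_minus_commute)
          also have "\<dots> \<le> 1 / real (Suc k) * (p (s k t - f t) + p (f t)) + C * p (s k t - f t)"
            by (intro add_mono mult_mono[OF \<psi>\<phi>[OF t] p_le_diff[OF p] _ p_nonneg[OF p]]
                mult_right_mono[OF C(2)[OF t] p_nonneg[OF p]]) simp
          finally show ?thesis by (simp add: p_nonneg[OF p])
        qed
        ultimately show "(\<lambda>k. p (s' k t - scl (\<phi> t) (f t))) \<longlonglongrightarrow> 0"
          by (rule Lim_null_comparison[OF always_eventually[OF allI], rotated])
      qed
    qed
    \<comment> \<open>The exceptional null set is carried from \<open>K\<close> to its subset
      \<open>K'\<close> through the measure on the whole space.\<close>
    then have "AE t in lebesgue. t \<in> K \<longrightarrow> (\<forall>p\<in>P. (\<lambda>k. p (s' k t - scl (\<phi> t) (f t))) \<longlonglongrightarrow> 0)"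
      unfolding M_def by (subst (asm) AE_restrict_space_iff) (use KL in auto)
    then have "AE t in lebesgue. t \<in> K' \<longrightarrow> (\<forall>p\<in>P. (\<lambda>k. p (s' k t - scl (\<phi> t) (f t))) \<longlonglongrightarrow> 0)"
      by eventually_elim (use K(3) in blast)
    then show "AE t in lebesgue_on K'. \<forall>p\<in>P. (\<lambda>k. p (s' k t - scl (\<phi> t) (f t))) \<longlonglongrightarrow> 0"
      by (subst AE_restrict_space_iff) (use KL in auto)
  next
    fix \<epsilon> :: real and p assume e: "0 < \<epsilon>" and p: "p \<in> P"
    obtain L k1 where L: "0 \<le> L" "\<And>k. k1 \<le> k \<Longrightarrow> (LINT t|M. p (s k t)) \<le> L"
      using approx_simple_L1_bounded[OF K(1) s p] unfolding M_def by metis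
    obtain k2 where k2: "\<And>k m. k2 \<le> k \<Longrightarrow> k2 \<le> m \<Longrightarrow> (LINT t|M. p (s k t - s m t)) \<le> \<epsilon> / (2 * (C + 1))"
      using approx_simple_D(3)[OF s p, of "\<epsilon> / (2 * (C + 1))"] e C(1) unfolding M_def by auto
    \<comment> \<open>The threshold \<open>k3\<close> makes the effect of exchanging
      \<open>\<psi> k\<close> for \<open>\<psi> m\<close> at most \<open>\<epsilon> / 2\<close>:
      each is within \<open>1 / Suc k3\<close> of \<open>\<phi>\<close>, and \<open>L\<close> bounds
      the integrals of \<open>p (s m t)\<close>.\<close>
    have "(\<lambda>k. 1 / real (Suc k) * (2 * L)) \<longlonglongrightarrow> 0 * (2 * L)" by (intro tendsto_intros inv)
    then have "eventually (\<lambda>k. 1 / real (Suc k) * (2 * L) < \<epsilon> / 2) sequentially"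
      using e by (intro order_tendstoD(2)[of _ 0]) auto
    then obtain k3 where k3: "1 / real (Suc k3) * (2 * L) < \<epsilon> / 2"
      unfolding eventually_sequentially by blast
    have inv3: "1 / real (Suc k) \<le> 1 / real (Suc k3)" if "k3 \<le> k" for k
      using that by (simp add: field_simps)
    show "\<exists>k0. \<forall>k\<ge>k0. \<forall>m\<ge>k0. (LINT t|lebesgue_on K'. p (s' k t - s' m t)) \<le> \<epsilon>"
    proof (intro exI allI impI)
      fix k m assume k: "k1 + k2 + k3 \<le> k" and m: "k1 + k2 + k3 \<le> m"
      have int: "integrable M (\<lambda>t. p (s' k t - s' m t))" "integrable M (\<lambda>t. p (s k t - s m t))"
        "integrable M (\<lambda>t. p (s m t))"
        by (intro integrable_p_simple fin simple_function_diff simple s'M)+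
      have "(LINT t|lebesgue_on K'. p (s' k t - s' m t)) \<le> (LINT t|M. p (s' k t - s' m t))"
        unfolding M_def using int(1)
        by (intro integral_restrict_le KL K(3) p_nonneg p) (simp add: M_def)
      also have "\<dots> \<le> (LINT t|M. (C + 1) * p (s k t - s m t) + (1 / real (Suc k3) * 2) * p (s m t))"
      proof (intro Bochner_Integration.integral_mono int Bochner_Integration.integrable_add integrable_mult_right)
        fix t assume "t \<in> space M"
        then have t: "t \<in> K" by (simp add: spaceM)
        have 1: "cmod (\<phi> t - \<psi> k t) \<le> 1 / real (Suc k3)" "cmod (\<phi> t - \<psi> m t) \<le> 1 / real (Suc k3)"
          using \<psi>\<phi>[OF t, of k] \<psi>\<phi>[OF t, of m] inv3[of k] inv3[of m] k m by linarith+
        then have 2: "cmod (\<psi> k t - \<psi> m t) \<le> 1 / real (Suc k3) * 2"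
          using norm_triangle_ineq4[of "\<phi> t - \<psi> m t" "\<phi> t - \<psi> k t"] by simp
        have "1 / real (Suc k3) \<le> 1" by simp
        moreover have "cmod (\<psi> k t) \<le> cmod (\<phi> t) + cmod (\<phi> t - \<psi> k t)"
          using norm_triangle_ineq4[of "\<phi> t" "\<phi> t - \<psi> k t"] by simp
        ultimately have 3: "cmod (\<psi> k t) \<le> C + 1" using 1(1) C(2)[OF t] by linarith
        have "s' k t - s' m t = scl (\<psi> k t) (s k t - s m t) + scl (\<psi> k t - \<psi> m t) (s m t)"
          by (simp add: s'_def scale_left_diff_distrib scale_right_diff_distrib)
        then have "p (s' k t - s' m t) \<le> cmod (\<psi> k t) * p (s k t - s m t) + cmod (\<psi> k t - \<psi> m t) * p (s m t)"
          using p_triangle[OF p, of "scl (\<psi> k t) (s k t - s m t)" "scl (\<psi> k t - \<psi> m t) (s m t)"]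
          by (simp add: p_scale[OF p])
        also have "\<dots> \<le> (C + 1) * p (s k t - s m t) + (1 / real (Suc k3) * 2) * p (s m t)"
          by (intro add_mono mult_right_mono 2 3 p_nonneg p)
        finally show "p (s' k t - s' m t) \<le> (C + 1) * p (s k t - s m t) + (1 / real (Suc k3) * 2) * p (s m t)" .
      qed
      also have "\<dots> = (C + 1) * (LINT t|M. p (s k t - s m t)) + (1 / real (Suc k3) * 2) * (LINT t|M. p (s m t))"
        using int by (subst Bochner_Integration.integral_add) auto
      also have "\<dots> \<le> (C + 1) * (\<epsilon> / (2 * (C + 1))) + (1 / real (Suc k3) * 2) * L"
        using C(1) k m by (intro add_mono mult_left_mono k2 L) auto
      also have "(C + 1) * (\<epsilon> / (2 * (C + 1))) = \<epsilon> / 2" using C(1) by (simp add: field_simps)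
      also have "\<epsilon> / 2 + (1 / real (Suc k3) * 2) * L \<le> \<epsilon>" using k3 by (simp add: mult.assoc)
      finally show "(LINT t|lebesgue_on K'. p (s' k t - s' m t)) \<le> \<epsilon>" .
    qed
  qed
  show ?thesis
  proof (rule integral_K_eqI[OF K(2) approx])
    fix p assume p: "p \<in> P"
    obtain L k1 where L: "0 \<le> L" "\<And>k. k1 \<le> k \<Longrightarrow> (LINT t|M. p (s k t)) \<le> L"
      using approx_simple_L1_bounded[OF K(1) s p] unfolding M_def by metis
    have "(\<lambda>k. 1 / real (Suc k) * L + p (wint M (\<lambda>t. indicator K' t * \<phi> t) (s k) - l)) \<longlonglongrightarrow> 0 * L + 0"
      using l[OF p, folded M_def] by (intro tendsto_intros inv)
    then have lim: "(\<lambda>k. 1 / real (Suc k) * L + p (wint M (\<lambda>t. indicator K' t * \<phi> t) (s k) - l)) \<longlonglongrightarrow> 0"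
      by simp
    have "norm (p (simple_integral_on scl K' (s' k) - l)) \<le>
        1 / real (Suc k) * L + p (wint M (\<lambda>t. indicator K' t * \<phi> t) (s k) - l)" if k: "k1 \<le> k" for k
    proof -
      have \<psi>K': "simple_function (lebesgue_on K') (\<psi> k)" "simple_function (lebesgue_on K') (s k)"
        by (rule simple_function_subset[OF KL K(3) \<psi>[unfolded M_def]],
            rule simple_function_subset[OF KL K(3) simple[unfolded M_def]])
      have ind: "bounded_weight M (indicator K')"
        unfolding M_def by (rule bounded_weight_indicator[OF KL(2)])
      have i\<phi>: "integrable M (\<lambda>t. indicator K' t * \<phi> t)"
        by (intro bounded_weight_integrable[OF fin] bounded_weight_mult ind \<phi>M)
      have i\<psi>: "integrable M (\<lambda>t. indicator K' t * (\<psi> k t - \<phi> t))"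
      proof (rule Bochner_Integration.integrable_bound)
        show "integrable M (\<lambda>t. \<psi> k t - \<phi> t)"
          by (intro Bochner_Integration.integrable_diff integrable_simple fin \<psi> bounded_weight_integrable \<phi>M)
        then show "(\<lambda>t. indicator K' t * (\<psi> k t - \<phi> t)) \<in> borel_measurable M"
          using ind unfolding bounded_weight_def by (intro borel_measurable_times) auto
      qed (auto simp: indicator_def)
      have "simple_integral_on scl K' (s' k) = wint (lebesgue_on K') (\<psi> k) (s k)"
        unfolding simple_integral_eq_wint[OF K(2) s'K']
        using wint_scale_simple[OF finite_measure_compact[OF K(2)] \<psi>K'] by (simp add: s'_def[abs_def])
      also have "\<dots> = wint M (\<lambda>t. indicator K' t * \<psi> k t) (s k)"
        unfolding M_def using simple[unfolded M_def] by (intro wint_restrict KL K(3))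
      \<comment> \<open>The first summand has a weight of modulus at most \<open>1 / Suc k\<close>
        and vanishes in the limit; the second is the sequence converging to \<open>l\<close> by
        assumption.\<close>
      also have "\<dots> = wint M (\<lambda>t. indicator K' t * (\<psi> k t - \<phi> t)) (s k) + wint M (\<lambda>t. indicator K' t * \<phi> t) (s k)"
        by (subst wint_add[OF simple i\<psi> i\<phi>, symmetric]) (simp add: algebra_simps)
      finally have eq: "simple_integral_on scl K' (s' k) - l =
          wint M (\<lambda>t. indicator K' t * (\<psi> k t - \<phi> t)) (s k) + (wint M (\<lambda>t. indicator K' t * \<phi> t) (s k) - l)"
        by simp
      have "cmod (indicator K' t * (\<psi> k t - \<phi> t)) \<le> 1 / real (Suc k)" if "t \<in> space M" for t
        using \<psi>\<phi>[of t k] that by (simp add: indicator_def spaceM norm_minus_commute)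
      then have "p (wint M (\<lambda>t. indicator K' t * (\<psi> k t - \<phi> t)) (s k)) \<le> 1 / real (Suc k) * (LINT t|M. p (s k t))"
        by (intro wint_bound p fin simple i\<psi>)
      also have "\<dots> \<le> 1 / real (Suc k) * L" using L(2)[OF k] by (intro mult_left_mono) auto
      finally show ?thesis
        unfolding eq using p_triangle[OF p, of "wint M (\<lambda>t. indicator K' t * (\<psi> k t - \<phi> t)) (s k)"
            "wint M (\<lambda>t. indicator K' t * \<phi> t) (s k) - l"]
          p_nonneg[OF p]
        by (smt (verit) real_norm_def)
    qed
    then show "(\<lambda>k. p (simple_integral_on scl K' (s' k) - l)) \<longlonglongrightarrow> 0"
      by (intro Lim_null_comparison[OF eventually_sequentiallyI lim])
  qed
qed

end

subsection \<open>Weighted integrals and partial Laplace integrals\<close>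

context sclcs
begin

text \<open>The limit exists for bounded weights by \<open>wint_convergent\<close>. Fixing one
  compact set and one approximating sequence turns the integrals over all compact subsets into
  values of a single linear functional of the weight.\<close>

definition weighted_integral :: "(real ^ 'n) set \<Rightarrow> (nat \<Rightarrow> real ^ 'n \<Rightarrow> 'x) \<Rightarrow> (real ^ 'n \<Rightarrow> complex) \<Rightarrow> 'x" where
  "weighted_integral K s \<phi> =
     (SOME l. \<forall>p\<in>P. (\<lambda>k. p (wint (lebesgue_on K) \<phi> (s k) - l)) \<longlonglongrightarrow> 0)"

lemma weighted_integral_cong:
  assumes "\<And>t. t \<in> K \<Longrightarrow> \<phi> t = \<psi> t"
  shows "weighted_integral K s \<phi> = weighted_integral K s \<psi>"
proof -
  have "wint (lebesgue_on K) \<phi> (s k) = wint (lebesgue_on K) \<psi> (s k)" for k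
    using assms by (intro wint_cong) simp
  then show ?thesis unfolding weighted_integral_def by simp
qed

context
  fixes K :: "(real ^ 'n) set" and f s
  assumes K: "compact K" and s: "approx_simple T P K f s"
begin

lemma simple_function_s: "simple_function (lebesgue_on K) (s k)"
  by (rule approx_simple_D(1)[OF s])

lemma finite_measure_K: "finite_measure (lebesgue_on K)"
  by (rule finite_measure_compact[OF K])

lemma weighted_integral_tendsto:
  assumes "bounded_weight (lebesgue_on K) \<phi>" "p \<in> P"
  shows "(\<lambda>k. p (wint (lebesgue_on K) \<phi> (s k) - weighted_integral K s \<phi>)) \<longlonglongrightarrow> 0"
  using someI_ex[OF wint_convergent[OF K s assms(1)]] assms(2) unfolding weighted_integral_def by blast

lemma weighted_integral_add:
  assumes "bounded_weight (lebesgue_on K) \<phi>" "bounded_weight (lebesgue_on K) \<psi>"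
  shows "weighted_integral K s (\<lambda>t. \<phi> t + \<psi> t) = weighted_integral K s \<phi> + weighted_integral K s \<psi>"
proof (rule limit_unique)
  fix p assume p: "p \<in> P"
  let ?w = "\<lambda>k. wint (lebesgue_on K) (\<lambda>t. \<phi> t + \<psi> t) (s k)"
  show "(\<lambda>k. p (?w k - weighted_integral K s (\<lambda>t. \<phi> t + \<psi> t))) \<longlonglongrightarrow> 0"
    by (intro weighted_integral_tendsto bounded_weight_add assms p)
  have "norm (p (?w k - (weighted_integral K s \<phi> + weighted_integral K s \<psi>))) \<le>
      p (wint (lebesgue_on K) \<phi> (s k) - weighted_integral K s \<phi>) +
      p (wint (lebesgue_on K) \<psi> (s k) - weighted_integral K s \<psi>)" for k
    using p_triangle[OF p, of "wint (lebesgue_on K) \<phi> (s k) - weighted_integral K s \<phi>"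
        "wint (lebesgue_on K) \<psi> (s k) - weighted_integral K s \<psi>"]
    by (simp add: wint_add[OF simple_function_s] bounded_weight_integrable[OF finite_measure_K] assms p_nonneg[OF p] algebra_simps)
  then show "(\<lambda>k. p (?w k - (weighted_integral K s \<phi> + weighted_integral K s \<psi>))) \<longlonglongrightarrow> 0"
    by (rule Lim_null_comparison[OF always_eventually[OF allI]])
      (intro tendsto_add_zero weighted_integral_tendsto assms p)
qed

lemma weighted_integral_scale:
  assumes "bounded_weight (lebesgue_on K) \<phi>"
  shows "weighted_integral K s (\<lambda>t. c * \<phi> t) = scl c (weighted_integral K s \<phi>)"
proof (rule limit_unique)
  fix p assume p: "p \<in> P"
  let ?w = "\<lambda>k. wint (lebesgue_on K) (\<lambda>t. c * \<phi> t) (s k)"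
  show "(\<lambda>k. p (?w k - weighted_integral K s (\<lambda>t. c * \<phi> t))) \<longlonglongrightarrow> 0"
    by (intro weighted_integral_tendsto bounded_weight_mult bounded_weight_const assms p)
  have "p (?w k - scl c (weighted_integral K s \<phi>)) =
      cmod c * p (wint (lebesgue_on K) \<phi> (s k) - weighted_integral K s \<phi>)" for k
    by (simp add: wint_scale scale_right_diff_distrib[symmetric] p_scale[OF p])
  then show "(\<lambda>k. p (?w k - scl c (weighted_integral K s \<phi>))) \<longlonglongrightarrow> 0"
    using tendsto_mult_right_zero[OF weighted_integral_tendsto[OF assms p], of "cmod c"] by simp
qed

lemma weighted_integral_diff:
  assumes "bounded_weight (lebesgue_on K) \<phi>" "bounded_weight (lebesgue_on K) \<psi>"
  shows "weighted_integral K s (\<lambda>t. \<phi> t - \<psi> t) = weighted_integral K s \<phi> - weighted_integral K s \<psi>"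
  using weighted_integral_add[OF bounded_weight_diff[OF assms] assms(2)] by (simp add: algebra_simps)

lemma weighted_integral_sum:
  assumes "\<And>i. i \<in> A \<Longrightarrow> bounded_weight (lebesgue_on K) (\<phi> i)"
  shows "weighted_integral K s (\<lambda>t. \<Sum>i\<in>A. \<phi> i t) = (\<Sum>i\<in>A. weighted_integral K s (\<phi> i))"
proof -
  have zero: "weighted_integral K s (\<lambda>t. 0) = 0"
    using weighted_integral_scale[OF bounded_weight_const[of _ 0], of 0] by simp
  show ?thesis
    using assms by (induction A rule: infinite_finite_induct)
      (simp_all add: zero weighted_integral_add bounded_weight_sum)
qed

text \<open>Continuity of the functional in the supremum norm of the weight: \<open>L\<close> comes
  from the L1 bound of the approximating sequence and does not depend on \<open>\<phi>\<close>.
  Uniform approximation of weights therefore passes to the integrals.\<close>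

lemma weighted_integral_bound:
  assumes p: "p \<in> P"
  obtains L where "0 \<le> L" "\<And>\<phi> B. bounded_weight (lebesgue_on K) \<phi> \<Longrightarrow> 0 \<le> B \<Longrightarrow>
    (\<And>t. t \<in> K \<Longrightarrow> cmod (\<phi> t) \<le> B) \<Longrightarrow> p (weighted_integral K s \<phi>) \<le> B * L"
proof -
  obtain L k0 where L: "0 \<le> L" "\<And>k. k0 \<le> k \<Longrightarrow> (LINT t|lebesgue_on K. p (s k t)) \<le> L"
    using approx_simple_L1_bounded[OF K s p] by blast
  have "p (weighted_integral K s \<phi>) \<le> B * L"
    if \<phi>: "bounded_weight (lebesgue_on K) \<phi>" and B: "0 \<le> B" "\<And>t. t \<in> K \<Longrightarrow> cmod (\<phi> t) \<le> B" for \<phi> B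
  proof -
    have lim: "(\<lambda>k. B * L + p (wint (lebesgue_on K) \<phi> (s k) - weighted_integral K s \<phi>)) \<longlonglongrightarrow> B * L + 0"
      by (intro tendsto_intros weighted_integral_tendsto \<phi> p)
    have "p (weighted_integral K s \<phi>) \<le> B * L + p (wint (lebesgue_on K) \<phi> (s k) - weighted_integral K s \<phi>)"
      if "k0 \<le> k" for k
    proof -
      have "p (wint (lebesgue_on K) \<phi> (s k)) \<le> B * (LINT t|lebesgue_on K. p (s k t))"
        using B by (intro wint_bound p finite_measure_K simple_function_s bounded_weight_integrable \<phi>) simp
      also have "\<dots> \<le> B * L" by (intro mult_left_mono L B that)
      finally show ?thesis
        using p_le_diff[OF p, of "weighted_integral K s \<phi>" "wint (lebesgue_on K) \<phi> (s k)"]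
        by (simp add: p_commute[OF p])
    qed
    then have "p (weighted_integral K s \<phi>) \<le> B * L + 0"
      by (intro LIMSEQ_le_const[OF lim] exI[of _ k0]) blast
    then show ?thesis by simp
  qed
  then show ?thesis using L(1) that by blast
qed

lemma integral_K_eq_weighted_integral:
  assumes "compact K'" "K' \<subseteq> K" "bounded_weight (lebesgue_on K) \<phi>"
  shows "integral_K scl T P K' (\<lambda>t. scl (\<phi> t) (f t)) = weighted_integral K s (\<lambda>t. indicator K' t * \<phi> t)"
  by (intro integral_K_weighted[OF K assms(1,2) s assms(3)] weighted_integral_tendsto
      bounded_weight_mult bounded_weight_indicator sets_compact assms)

end

section \<open>Product weights on a box and step approximation of their factors\<close>

lemma bounded_weight_component:
  fixes b :: "real ^ 'n"
  assumes h: "h \<in> borel_measurable borel" and B: "\<And>x. x \<in> {0..b $ j} \<Longrightarrow> cmod (h x) \<le> B"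
  shows "bounded_weight (lebesgue_on (cbox 0 b)) (\<lambda>x. h (x $ j))"
proof -
  have "(\<lambda>x. h (x $ j)) \<in> borel_measurable borel"
    by (rule measurable_compose[OF _ h]) (intro borel_measurable_continuous_onI continuous_intros)
  then have "(\<lambda>x. h (x $ j)) \<in> borel_measurable (lebesgue_on (cbox 0 b))"
    by (intro measurable_restrict_space1 measurable_completion) simp
  then show ?thesis
    using B unfolding bounded_weight_def by (auto simp: mem_box_cart intro!: exI[of _ B])
qed

text \<open>The factors \<open>h j\<close> replace the indicators of \<open>{..a $ j}\<close> one coordinate at a time.\<close>

lemma weighted_integral_step_approx_le:
  fixes b :: "real ^ 'n"
  assumes s: "approx_simple T P (cbox 0 b) f s" and p: "p \<in> P"
    and E: "bounded_weight (lebesgue_on (cbox 0 b)) E"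
    and B: "\<And>a. a \<in> cbox 0 b \<Longrightarrow>
      p (weighted_integral (cbox 0 b) s (\<lambda>x. (\<Prod>j\<in>UNIV. indicator {..a $ j} (x $ j)) * E x)) \<le> B"
    and h: "\<And>j. step_approx (b $ j) (C j) (h j)" and b: "0 \<in> cbox 0 b"
  shows "p (weighted_integral (cbox 0 b) s (\<lambda>x. (\<Prod>j\<in>UNIV. h j (x $ j)) * E x)) \<le> B * (\<Prod>j\<in>UNIV. C j)"
proof -
  define K where "K = cbox 0 b"
  have K: "compact K" by (simp add: K_def)
  note sK = s[folded K_def]
  obtain L where L: "0 \<le> L" "\<And>\<phi> B. bounded_weight (lebesgue_on K) \<phi> \<Longrightarrow> 0 \<le> B \<Longrightarrow>
    (\<And>t. t \<in> K \<Longrightarrow> cmod (\<phi> t) \<le> B) \<Longrightarrow> p (weighted_integral K s \<phi>) \<le> B * L"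
    using weighted_integral_bound[OF K sK p] by blast
  have hw: "bounded_weight (lebesgue_on K) (\<lambda>x. h j (x $ j))" for j
    unfolding K_def
    by (rule bounded_weight_component[OF _ step_approx_bounded[OF h]]) (use h in \<open>simp add: step_approx_def\<close>)
  have iw: "bounded_weight (lebesgue_on K) (\<lambda>x. indicator {..r} (x $ j))" for j and r :: real
    unfolding K_def by (rule bounded_weight_component[of _ _ _ 1]) (auto simp: indicator_def)
  \<comment> \<open>Hybrid products: coordinates in \<open>A\<close> already carry
    \<open>h j\<close>, the others still carry an indicator. The corner \<open>a\<close> stays
    arbitrary, since the induction step applies the hypothesis with different values in the new
    coordinate.\<close>
  have "p (weighted_integral K s (\<lambda>x. (\<Prod>j\<in>UNIV. (if j \<in> A then h j else indicator {..a $ j}) (x $ j)) * E x))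
      \<le> B * (\<Prod>j\<in>A. C j)" if "a \<in> K" "finite A" for A a
    using that(2,1)
  proof (induction A arbitrary: a rule: finite_induct)
    case empty
    then show ?case using B[of a] by (simp add: K_def)
  next
    case (insert k A)
    \<comment> \<open>All factors except the one of coordinate \<open>k\<close>, so that the
      functional is studied as a function of this one factor.\<close>
    define G where "G x = (\<Prod>j\<in>UNIV-{k}. (if j \<in> A then h j else indicator {..a $ j}) (x $ j)) * E x" for x
    have Gw: "bounded_weight (lebesgue_on K) G"
      unfolding G_def[abs_def]
      by (intro bounded_weight_mult bounded_weight_prod E[folded K_def]) (use hw iw in \<open>auto split: if_splits\<close>)
    obtain D where D: "\<And>x. x \<in> K \<Longrightarrow> cmod (G x) \<le> D"
      using Gw unfolding bounded_weight_def by auto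
    have D0: "0 \<le> D" using D[of 0] b norm_ge_zero[of "G 0"] unfolding K_def by linarith
    have split: "(\<Prod>j\<in>UNIV. g j (x $ j)) * E x = g k (x $ k) * G x"
      if "\<And>j. j \<noteq> k \<Longrightarrow> g j = (if j \<in> A then h j else indicator {..a $ j})" for g x
      unfolding G_def using that by (subst prod.remove[of UNIV k]) (auto intro!: prod.cong)
    have IH: "p (weighted_integral K s (\<lambda>x. indicator {..r} (x $ k) * G x)) \<le> B * (\<Prod>j\<in>A. C j)"
      if r: "0 \<le> r" "r \<le> b $ k" for r
    proof -
      define a' where "a' = (\<chi> j. if j = k then r else a $ j)"
      have "a' \<in> K" using insert.prems r by (auto simp: K_def mem_box_cart a'_def)
      from insert.IH[OF this] show ?thesis
        using split[of "\<lambda>j. if j \<in> A then h j else indicator {..a' $ j}"] insert.hyps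
        by (simp add: a'_def)
    qed
    \<comment> \<open>Nonnegativity is read off from the induction hypothesis itself, whose
      left-hand side is a seminorm; it allows multiplication by the mass estimate.\<close>
    have BC: "0 \<le> B * (\<Prod>j\<in>A. C j)"
      using order_trans[OF p_nonneg[OF p] IH[of 0]] b by (simp add: mem_box_cart)
    have "p (weighted_integral K s (\<lambda>x. h k (x $ k) * G x)) \<le> C k * (B * (\<Prod>j\<in>A. C j)) + \<epsilon>"
      if \<epsilon>: "0 < \<epsilon>" for \<epsilon>
    proof -
      \<comment> \<open>Chosen so that \<open>e * D * L \<le> \<epsilon>\<close>, where
        \<open>e * D\<close> bounds the change of the weight; the summand \<open>1\<close> avoids
        division by zero.\<close>
      define e where "e = \<epsilon> / (D * L + 1)"
      have DL: "0 < D * L + 1" using D0 L(1) by (simp add: add_nonneg_pos)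
      have e: "0 < e" using \<epsilon> DL by (simp add: e_def)
      obtain N c \<alpha> where N: "\<forall>i<N::nat. 0 \<le> \<alpha> i \<and> \<alpha> i \<le> b $ k" "(\<Sum>i<N. cmod (c i)) \<le> C k"
          "\<forall>x\<in>{0..b $ k}. cmod (h k x - (\<Sum>i<N. c i * indicator {..\<alpha> i} x)) \<le> e"
        by (rule step_approxE[OF h e])
      define S where "S x = (\<Sum>i<N. c i * (indicator {..\<alpha> i} (x $ k) * G x))" for x
      have Sw: "bounded_weight (lebesgue_on K) S"
        unfolding S_def[abs_def]
        by (intro bounded_weight_sum bounded_weight_mult bounded_weight_const iw Gw)
      have hG: "bounded_weight (lebesgue_on K) (\<lambda>x. h k (x $ k) * G x)"
        by (intro bounded_weight_mult hw Gw)
      have "weighted_integral K s S = (\<Sum>i<N. scl (c i) (weighted_integral K s (\<lambda>x. indicator {..\<alpha> i} (x $ k) * G x)))"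
        unfolding S_def[abs_def]
        by (subst weighted_integral_sum[OF K sK])
          (auto intro!: bounded_weight_mult bounded_weight_const iw Gw sum.cong weighted_integral_scale[OF K sK])
      then have "p (weighted_integral K s S) \<le>
          (\<Sum>i<N. cmod (c i) * p (weighted_integral K s (\<lambda>x. indicator {..\<alpha> i} (x $ k) * G x)))"
        using p_sum[OF p] by (simp add: p_scale[OF p, symmetric])
      also have "\<dots> \<le> (\<Sum>i<N. cmod (c i) * (B * (\<Prod>j\<in>A. C j)))"
        using N(1) by (intro sum_mono mult_left_mono IH) auto
      also have "\<dots> \<le> C k * (B * (\<Prod>j\<in>A. C j))"
        unfolding sum_distrib_right[symmetric] by (intro mult_right_mono N BC)
      finally have 1: "p (weighted_integral K s S) \<le> C k * (B * (\<Prod>j\<in>A. C j))" .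
      have "p (weighted_integral K s (\<lambda>x. h k (x $ k) * G x - S x)) \<le> e * D * L"
      proof (intro L(2) bounded_weight_diff hG Sw)
        show "0 \<le> e * D" using e D0 by simp
        fix x assume x: "x \<in> K"
        have "h k (x $ k) * G x - S x = (h k (x $ k) - (\<Sum>i<N. c i * indicator {..\<alpha> i} (x $ k))) * G x"
          by (simp only: S_def sum_distrib_right left_diff_distrib mult.assoc)
        moreover have "x $ k \<in> {0..b $ k}" using x by (simp add: K_def mem_box_cart)
        ultimately show "cmod (h k (x $ k) * G x - S x) \<le> e * D"
          using N(3) D[OF x] e by (simp add: norm_mult mult_mono)
      qed
      also have "e * D * L \<le> \<epsilon>"
        using \<epsilon> DL by (simp add: e_def field_simps)
      finally have 2: "p (weighted_integral K s (\<lambda>x. h k (x $ k) * G x) - weighted_integral K s S) \<le> \<epsilon>"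
        using weighted_integral_diff[OF K sK hG Sw] by simp
      show ?thesis
        using 1 2 p_le_diff[OF p, of "weighted_integral K s (\<lambda>x. h k (x $ k) * G x)" "weighted_integral K s S"]
        by linarith
    qed
    then have "p (weighted_integral K s (\<lambda>x. h k (x $ k) * G x)) \<le> C k * (B * (\<Prod>j\<in>A. C j))"
      by (rule field_le_epsilon)
    then show ?case
      using insert.hyps split[of "\<lambda>j. if j \<in> insert k A then h j else indicator {..a $ j}"]
      by (simp add: mult_ac)
  qed
  \<comment> \<open>For \<open>A = UNIV\<close> no indicator remains, so the choice of corner is
    immaterial; \<open>0\<close> is one in the box.\<close>
  from this[of 0 UNIV] show ?thesis using b by (simp add: K_def)
qed

lemma bounded_weight_kernel:
  fixes lam :: "complex ^ 'n"
  shows "bounded_weight (lebesgue_on (cbox 0 b)) (\<lambda>x. exp (- (\<Sum>j\<in>UNIV. lam $ j * complex_of_real (x $ j))))"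
proof -
  let ?E = "\<lambda>x. exp (- (\<Sum>j\<in>UNIV. lam $ j * complex_of_real (x $ j)))"
  have cont: "continuous_on A ?E" for A by (intro continuous_intros)
  have "bounded (?E ` cbox 0 b)"
    by (intro compact_imp_bounded compact_continuous_image cont compact_cbox)
  moreover have "?E \<in> borel_measurable (lebesgue_on (cbox 0 b))"
    by (intro measurable_restrict_space1 measurable_completion) (simp add: borel_measurable_continuous_onI[OF cont])
  ultimately show ?thesis unfolding bounded_weight_def bounded_iff by auto
qed

text \<open>Inside \<open>cbox 0 b\<close> the lower constraints hold automatically, so the
  indicator of \<open>cbox 0 t\<close> factors into indicators of initial segments. All corners
  \<open>t\<close> of the larger box share the same sequence \<open>s\<close>.\<close>

lemma partial_laplace_eq_weighted_integral:
  fixes lam :: "complex ^ 'n"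
  assumes s: "approx_simple T P (cbox 0 b) f s" and t: "t \<in> cbox 0 b"
  shows "partial_laplace scl T P f lam t = weighted_integral (cbox 0 b) s
    (\<lambda>x. (\<Prod>j\<in>UNIV. indicator {..t $ j} (x $ j)) * exp (- (\<Sum>j\<in>UNIV. lam $ j * complex_of_real (x $ j))))"
proof -
  have "cbox 0 t \<subseteq> cbox 0 b" using t unfolding mem_box_cart subset_iff by (meson order_trans)
  then have "partial_laplace scl T P f lam t = weighted_integral (cbox 0 b) s
    (\<lambda>x. indicator (cbox 0 t) x * exp (- (\<Sum>j\<in>UNIV. lam $ j * complex_of_real (x $ j))))"
    unfolding partial_laplace_def
    by (intro integral_K_eq_weighted_integral[OF compact_cbox s] compact_cbox bounded_weight_kernel)
  moreover have "indicator (cbox 0 t) x = (\<Prod>j\<in>UNIV. indicator {..t $ j} (x $ j) :: complex)" if x: "x \<in> cbox 0 b" for x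
  proof (cases "\<forall>j. x $ j \<le> t $ j")
    case True
    then show ?thesis using x by (simp add: mem_box_cart)
  next
    case False
    then have "\<exists>j. indicator {..t $ j} (x $ j) = (0 :: complex)" by (auto simp: indicator_def)
    then have "(\<Prod>j\<in>UNIV. indicator {..t $ j} (x $ j) :: complex) = 0" by (intro prod_zero) auto
    then show ?thesis using False by (auto simp: mem_box_cart indicator_def)
  qed
  ultimately show ?thesis by (simp cong: weighted_integral_cong)
qed

lemma exp_shift_prod:
  fixes lam lam0 :: "complex ^ 'n"
  shows "exp (- (\<Sum>j\<in>UNIV. lam $ j * complex_of_real (x $ j))) =
    (\<Prod>j\<in>UNIV. exp (- ((lam $ j - lam0 $ j) * complex_of_real (x $ j)))) *
    exp (- (\<Sum>j\<in>UNIV. lam0 $ j * complex_of_real (x $ j)))"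
proof -
  have "- (\<Sum>j\<in>UNIV. lam $ j * complex_of_real (x $ j)) =
      (\<Sum>j\<in>UNIV. - ((lam $ j - lam0 $ j) * complex_of_real (x $ j))) +
      - (\<Sum>j\<in>UNIV. lam0 $ j * complex_of_real (x $ j))"
    by (simp add: sum_negf[symmetric] sum.distrib[symmetric] left_diff_distrib)
  then show ?thesis by (simp only: exp_add exp_sum[OF finite])
qed

section \<open>Boundedness and decay estimates for one fixed seminorm\<close>

context
  fixes f :: "real ^ 'n \<Rightarrow> 'x" and lam0 lam :: "complex ^ 'n" and p and B :: real
  assumes f: "locally_integrable T P f" and p: "p \<in> P"
    and B: "\<And>t. t \<in> orthant \<Longrightarrow> p (partial_laplace scl T P f lam0 t) \<le> B"
    and lam: "\<And>j. Re (lam $ j) > Re (lam0 $ j)"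
begin

definition mu :: "'n \<Rightarrow> complex" where "mu j = lam $ j - lam0 $ j"

text \<open>The mass of the step approximations of \<open>exp (- mu j * x)\<close>; geometrically,
  the reciprocal of the cosine of the argument of \<open>mu j\<close>.\<close>

definition ratio :: "'n \<Rightarrow> real" where "ratio j = cmod (mu j) / Re (mu j)"

lemma mu_pos: "0 < Re (mu j)"
  using lam[of j] by (simp add: mu_def)

lemma approx_simple_cbox:
  obtains s where "approx_simple T P (cbox 0 b) f s"
proof -
  have "compact (cbox 0 b)" "cbox 0 b \<subseteq> orthant"
    by (auto simp: orthant_def mem_box_cart)
  then show ?thesis using f that unfolding locally_integrable_def integrable_K_def by blast
qed

lemma weighted_integral_step_approx_kernel_le:
  assumes s: "approx_simple T P (cbox 0 b) f s" and b: "b \<in> orthant"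
    and h: "\<And>j. step_approx (b $ j) (C j) (h j)"
  shows "p (weighted_integral (cbox 0 b) s (\<lambda>x. (\<Prod>j\<in>UNIV. h j (x $ j)) *
    exp (- (\<Sum>j\<in>UNIV. lam0 $ j * complex_of_real (x $ j))))) \<le> B * (\<Prod>j\<in>UNIV. C j)"
proof (rule weighted_integral_step_approx_le[OF s p bounded_weight_kernel _ h])
  fix a assume a: "a \<in> cbox 0 b"
  then have "a \<in> orthant" by (simp add: orthant_def mem_box_cart)
  from B[OF this] show "p (weighted_integral (cbox 0 b) s (\<lambda>x. (\<Prod>j\<in>UNIV. indicator {..a $ j} (x $ j)) *
      exp (- (\<Sum>j\<in>UNIV. lam0 $ j * complex_of_real (x $ j))))) \<le> B"
    by (simp add: partial_laplace_eq_weighted_integral[OF s a])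
qed (use b in \<open>simp add: orthant_def mem_box_cart\<close>)

text \<open>The box \<open>cbox 0 t\<close> itself is the ambient compact set. It varies with
  \<open>t\<close>, but the masses \<open>ratio j\<close> do not, so the estimate is
  uniform.\<close>

lemma partial_laplace_bound:
  assumes t: "t \<in> orthant"
  shows "p (partial_laplace scl T P f lam t) \<le> B * (\<Prod>j\<in>UNIV. ratio j)"
proof -
  obtain s where s: "approx_simple T P (cbox 0 t) f s" by (rule approx_simple_cbox)
  have "t \<in> cbox 0 t" using t by (simp add: orthant_def mem_box_cart)
  from partial_laplace_eq_weighted_integral[OF s this]
  have "partial_laplace scl T P f lam t = weighted_integral (cbox 0 t) s
    (\<lambda>x. (\<Prod>j\<in>UNIV. indicator {..t $ j} (x $ j) * exp (- (mu j * complex_of_real (x $ j)))) *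
      exp (- (\<Sum>j\<in>UNIV. lam0 $ j * complex_of_real (x $ j))))"
    by (simp only: exp_shift_prod[of lam _ lam0] prod.distrib mu_def mult.assoc)
  then show ?thesis
    using weighted_integral_step_approx_kernel_le[OF s t step_approx_exp[OF mu_pos _ order.refl]] t
    by (simp add: orthant_def ratio_def)
qed

text \<open>Two products that differ in one factor have as difference the product with the
  difference of these factors, here the exponential on \<open>{t $ k<..v}\<close>. Its mass decays
  like \<open>exp (- (Re (mu k) * t $ k))\<close>, while the other coordinates contribute their
  fixed masses.\<close>

lemma partial_laplace_change_coordinate:
  assumes t: "t \<in> orthant" and v: "t $ k \<le> v"
  shows "p (partial_laplace scl T P f lam (\<chi> j. if j = k then v else t $ j) - partial_laplace scl T P f lam t)
    \<le> 2 * B * (\<Prod>j\<in>UNIV. ratio j) * exp (- (Re (mu k) * t $ k))"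
proof -
  \<comment> \<open>The box of the farther corner contains both corners, so both integrals can be
    written with one approximating sequence and subtracted.\<close>
  define b where "b = (\<chi> j. if j = k then v else t $ j)"
  obtain s where s: "approx_simple T P (cbox 0 b) f s" by (rule approx_simple_cbox)
  have t0: "0 \<le> t $ j" for j using t by (simp add: orthant_def)
  have tb: "t \<in> cbox 0 b" "b \<in> cbox 0 b" "b \<in> orthant"
    using t0 v order_trans[OF t0 v] by (auto simp: b_def mem_box_cart orthant_def)
  let ?W = "\<lambda>g. weighted_integral (cbox 0 b) s (\<lambda>x. (\<Prod>j\<in>UNIV. g j (x $ j)) *
      exp (- (\<Sum>j\<in>UNIV. lam0 $ j * complex_of_real (x $ j))))"
  define e where "e j x = exp (- (mu j * complex_of_real x))" for j x
  define h where "h j x = (if j = k then indicator {t $ k<..v} x * e j x else indicator {..t $ j} x * e j x)" for j x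
  have W: "partial_laplace scl T P f lam a = ?W (\<lambda>j x. indicator {..a $ j} x * e j x)" if "a \<in> cbox 0 b" for a
    unfolding partial_laplace_eq_weighted_integral[OF s that]
    by (simp only: exp_shift_prod[of lam _ lam0] prod.distrib mu_def e_def mult.assoc)
  have ew: "bounded_weight (lebesgue_on (cbox 0 b)) (\<lambda>x. (\<Prod>j\<in>UNIV. indicator {..a $ j} (x $ j) * e j (x $ j)) *
      exp (- (\<Sum>j\<in>UNIV. lam0 $ j * complex_of_real (x $ j))))" if a: "a \<in> cbox 0 b" for a
  proof (rule bounded_weight_mult[OF bounded_weight_prod bounded_weight_kernel])
    fix j
    have "0 \<le> a $ j" "a $ j \<le> b $ j" using a by (simp_all add: mem_box_cart)
    from step_approx_exp[OF mu_pos this] have *: "step_approx (b $ j) (ratio j) (\<lambda>x. indicator {..a $ j} x * e j x)"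
      by (simp add: ratio_def e_def)
    show "bounded_weight (lebesgue_on (cbox 0 b)) (\<lambda>x. indicator {..a $ j} (x $ j) * e j (x $ j))"
      by (rule bounded_weight_component[OF _ step_approx_bounded[OF *]]) (use * in \<open>simp add: step_approx_def\<close>)
  qed
  have diff: "(\<Prod>j\<in>UNIV. indicator {..b $ j} (x $ j) * e j (x $ j)) - (\<Prod>j\<in>UNIV. indicator {..t $ j} (x $ j) * e j (x $ j))
      = (\<Prod>j\<in>UNIV. h j (x $ j))" for x
  proof -
    have "(\<Prod>j\<in>UNIV-{k}. indicator {..b $ j} (x $ j) * e j (x $ j)) = (\<Prod>j\<in>UNIV-{k}. h j (x $ j))"
      "(\<Prod>j\<in>UNIV-{k}. indicator {..t $ j} (x $ j) * e j (x $ j)) = (\<Prod>j\<in>UNIV-{k}. h j (x $ j))"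
      by (auto intro!: prod.cong simp: b_def h_def)
    moreover have "indicator {..b $ k} (x $ k) * e k (x $ k) - indicator {..t $ k} (x $ k) * e k (x $ k) = h k (x $ k)"
      using v by (auto simp: b_def h_def indicator_def)
    ultimately show ?thesis
      by (simp add: prod.remove[of UNIV k] left_diff_distrib[symmetric])
  qed
  have hs: "step_approx (b $ j) (if j = k then 2 * ratio k * exp (- (Re (mu k) * t $ k)) else ratio j) (h j)" for j
    using step_approx_exp_Ioc[OF mu_pos[of k] t0 v order.refl] step_approx_exp[OF mu_pos[of j] t0 order.refl, of j]
    by (auto simp: h_def[abs_def] e_def ratio_def b_def)
  have "partial_laplace scl T P f lam b - partial_laplace scl T P f lam t = ?W h"
    unfolding W[OF tb(1)] W[OF tb(2)] weighted_integral_diff[OF compact_cbox s ew[OF tb(2)] ew[OF tb(1)], symmetric]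
    by (simp only: left_diff_distrib[symmetric] diff)
  then have "p (partial_laplace scl T P f lam b - partial_laplace scl T P f lam t) \<le>
      B * (\<Prod>j\<in>UNIV. if j = k then 2 * ratio k * exp (- (Re (mu k) * t $ k)) else ratio j)"
    using weighted_integral_step_approx_kernel_le[OF s tb(3) hs] by simp
  also have "\<dots> = 2 * B * (\<Prod>j\<in>UNIV. ratio j) * exp (- (Re (mu k) * t $ k))"
    by (simp add: prod.remove[of UNIV k] mult_ac)
  finally show ?thesis by (simp add: b_def)
qed

text \<open>The coordinates of \<open>t\<close> are exchanged for those of \<open>t'\<close> one at
  a time. Every intermediate point keeps all coordinates at least \<open>M\<close>, so each exchange
  costs one decaying term, whatever the order of the old and new value.\<close>

lemma partial_laplace_Cauchy:
  assumes M: "0 \<le> M" "\<And>j. M \<le> t $ j" "\<And>j. M \<le> t' $ j"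
  shows "p (partial_laplace scl T P f lam t' - partial_laplace scl T P f lam t)
    \<le> (\<Sum>k\<in>UNIV. 2 * B * (\<Prod>j\<in>UNIV. ratio j) * exp (- (Re (mu k) * M)))"
proof -
  define R where "R = 2 * B * (\<Prod>j\<in>UNIV. ratio j)"
  have R: "0 \<le> R"
  proof -
    have "0 \<in> (orthant :: (real ^ 'n) set)" by (simp add: orthant_def)
    from order_trans[OF p_nonneg[OF p] partial_laplace_bound[OF this]] show ?thesis
      by (simp add: R_def)
  qed
  have decay: "R * exp (- (Re (mu k) * v)) \<le> R * exp (- (Re (mu k) * M))" if "M \<le> v" for k v
    using mu_pos[of k] that R by (intro mult_left_mono) auto
  have one: "p (partial_laplace scl T P f lam (\<chi> j. if j = k then v else u $ j) - partial_laplace scl T P f lam u)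
      \<le> R * exp (- (Re (mu k) * M))" if u: "\<And>j. M \<le> u $ j" and v: "M \<le> v" for u k v
  proof (cases "u $ k \<le> v")
    case True
    have "u \<in> orthant" using u M(1) by (auto simp: orthant_def intro: order_trans)
    from partial_laplace_change_coordinate[OF this True] decay[OF u, of k k] show ?thesis
      by (simp add: R_def)
  next
    case False
    \<comment> \<open>When the coordinate decreases, the roles of the two points are interchanged:
      \<open>u\<close> arises from \<open>w\<close> by raising coordinate \<open>k\<close> from
      \<open>v\<close>, and \<open>M \<le> v\<close> gives the same bound.\<close>
    define w where "w = (\<chi> j. if j = k then v else u $ j)"
    have w: "w \<in> orthant" using u v M(1) by (auto simp: orthant_def w_def intro: order_trans)
    have "(\<chi> j. if j = k then u $ k else w $ j) = u" by (simp add: w_def vec_eq_iff)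
    moreover have "w $ k = v" by (simp add: w_def)
    ultimately have "p (partial_laplace scl T P f lam u - partial_laplace scl T P f lam w) \<le>
        R * exp (- (Re (mu k) * v))"
      using partial_laplace_change_coordinate[OF w, of k "u $ k"] False by (simp add: R_def)
    then show ?thesis
      using decay[OF v, of k] p_commute[OF p, of "partial_laplace scl T P f lam u"]
      unfolding w_def[symmetric] by simp
  qed
  have "p (partial_laplace scl T P f lam (\<chi> j. if j \<in> A then t' $ j else t $ j) - partial_laplace scl T P f lam t)
      \<le> (\<Sum>k\<in>A. R * exp (- (Re (mu k) * M)))" if "finite A" for A
    using that
  proof (induction A rule: finite_induct)
    case empty
    then show ?case by (simp add: p_zero[OF p])
  next
    case (insert k A)
    define u where "u = (\<chi> j. if j \<in> A then t' $ j else t $ j)"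
    have "M \<le> u $ j" for j using M by (simp add: u_def)
    moreover have "(\<chi> j. if j = k then t' $ k else u $ j) = (\<chi> j. if j \<in> insert k A then t' $ j else t $ j)"
      by (simp add: u_def vec_eq_iff)
    ultimately have "p (partial_laplace scl T P f lam (\<chi> j. if j \<in> insert k A then t' $ j else t $ j) -
        partial_laplace scl T P f lam u) \<le> R * exp (- (Re (mu k) * M))"
      using one[of u "t' $ k" k] M(3) by simp
    then show ?case
      using insert p_triangle_diff[OF p, of
        "partial_laplace scl T P f lam (\<chi> j. if j \<in> insert k A then t' $ j else t $ j)"
        "partial_laplace scl T P f lam t" "partial_laplace scl T P f lam u"]
      by (simp add: u_def)
  qed
  from this[of UNIV] show ?thesis by (simp add: R_def)
qed

lemma partial_laplace_Cauchy_eventually: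
  assumes "0 < \<epsilon>"
  obtains M where "0 < M" "\<And>t t'. (\<And>j. M \<le> t $ j) \<Longrightarrow> (\<And>j. M \<le> t' $ j) \<Longrightarrow>
    p (partial_laplace scl T P f lam t' - partial_laplace scl T P f lam t) < \<epsilon>"
proof -
  define R where "R = 2 * B * (\<Prod>j\<in>UNIV. ratio j)"
  have "((\<lambda>M::real. \<Sum>k\<in>UNIV. R * exp (- (Re (mu k) * M))) \<longlongrightarrow> (\<Sum>k\<in>(UNIV :: 'n set). R * 0)) at_top"
    by (intro tendsto_intros filterlim_compose[OF exp_at_bot]
        filterlim_compose[OF filterlim_uminus_at_bot_at_top]
        filterlim_tendsto_pos_mult_at_top[OF tendsto_const mu_pos filterlim_ident])
  then have "eventually (\<lambda>M. (\<Sum>k\<in>UNIV. R * exp (- (Re (mu k) * M))) < \<epsilon>) at_top"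
    using assms by (intro order_tendstoD(2)[of _ 0]) auto
  then obtain M0 where M0: "\<And>M. M0 \<le> M \<Longrightarrow> (\<Sum>k\<in>UNIV. R * exp (- (Re (mu k) * M))) < \<epsilon>"
    unfolding eventually_at_top_linorder by blast
  show ?thesis
  \<comment> \<open>The maximum with \<open>1\<close> ensures that the threshold is positive, as the
    notion of limit demands.\<close>
  proof (rule that[of "max 1 M0"])
    fix t t' :: "real ^ 'n" assume "\<And>j. max 1 M0 \<le> t $ j" "\<And>j. max 1 M0 \<le> t' $ j"
    from partial_laplace_Cauchy[OF _ this] M0[of "max 1 M0"]
    show "p (partial_laplace scl T P f lam t' - partial_laplace scl T P f lam t) < \<epsilon>"
      by (simp add: R_def le_max_iff_disj)
  qed simp
qed

end

end

section \<open>From uniform estimates to boundedness and a limit along the diagonal\<close>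

theorem theorem2p7:
  fixes scl :: "complex \<Rightarrow> 'x::ab_group_add \<Rightarrow> 'x"
    and T :: "'x topology" and P :: "('x \<Rightarrow> real) set"
    and f :: "real ^ 'n \<Rightarrow> 'x"
    and lam0 lam :: "complex ^ 'n"
  assumes "sclcs scl T P"
    and "2 \<le> CARD('n)"
    and "locally_integrable T P f"
    and "lam0 \<in> Omega_b scl T P f"
    and "\<And>j. Re (lam $ j) > Re (lam0 $ j)"
  shows "lam \<in> Omega_b scl T P f \<inter> Omega scl T P f"
proof
  interpret sclcs scl T P by (rule assms(1))
  have "\<exists>B. \<forall>t\<in>orthant. p (partial_laplace scl T P f lam0 t) \<le> B" if "p \<in> P" for p
    using assms(4) that by (simp add: Omega_b_def tvs_bounded_iff)
  then obtain B where B: "\<And>p t. p \<in> P \<Longrightarrow> t \<in> orthant \<Longrightarrow> p (partial_laplace scl T P f lam0 t) \<le> B p"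
    by metis
  have "\<exists>C. \<forall>x\<in>partial_laplace scl T P f lam ` orthant. p x \<le> C" if p: "p \<in> P" for p
    using partial_laplace_bound[OF assms(3) p B[OF p] assms(5)] by blast
  then show "lam \<in> Omega_b scl T P f"
    by (simp add: Omega_b_def tvs_bounded_iff)
  have Cauchy: "\<exists>M>0. \<forall>t t'. (\<forall>j. M \<le> t $ j) \<longrightarrow> (\<forall>j. M \<le> t' $ j) \<longrightarrow>
      p (partial_laplace scl T P f lam t' - partial_laplace scl T P f lam t) < \<epsilon>"
    if p: "p \<in> P" and \<epsilon>: "0 < \<epsilon>" for p \<epsilon>
    using partial_laplace_Cauchy_eventually[OF assms(3) p B[OF p] assms(5) \<epsilon>] by metis
  \<comment> \<open>Completeness is available for sequences only, so the limit is first taken along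
    the diagonal corners. The sequence does not depend on a seminorm, hence one \<open>F\<close>
    serves all of them.\<close>
  define u where "u k = partial_laplace scl T P f lam (\<chi> j. real k)" for k
  have "\<exists>F. \<forall>p\<in>P. (\<lambda>k. p (u k - F)) \<longlonglongrightarrow> 0"
  proof (rule convergent_of_Cauchy)
    fix p and \<epsilon> :: real assume p: "p \<in> P" and \<epsilon>: "0 < \<epsilon>"
    obtain M where M: "\<And>t t'. (\<And>j. M \<le> t $ j) \<Longrightarrow> (\<And>j. M \<le> t' $ j) \<Longrightarrow>
        p (partial_laplace scl T P f lam t' - partial_laplace scl T P f lam t) < \<epsilon>"
      using Cauchy[OF p \<epsilon>] by blast
    have "M \<le> real k" if "nat \<lceil>M\<rceil> \<le> k" for k using that by linarith
    then show "\<exists>N. \<forall>k\<ge>N. \<forall>m\<ge>N. p (u k - u m) < \<epsilon>"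
      unfolding u_def by (intro exI[of _ "nat \<lceil>M\<rceil>"] allI impI M) auto
  qed
  then obtain F where F: "\<And>p. p \<in> P \<Longrightarrow> (\<lambda>k. p (u k - F)) \<longlonglongrightarrow> 0" by blast
  have "\<exists>M>0. \<forall>t. (\<forall>j. M < t $ j) \<longrightarrow> p (partial_laplace scl T P f lam t - F) < \<epsilon>"
    if p: "p \<in> P" and \<epsilon>: "0 < \<epsilon>" for p \<epsilon>
  proof -
    have "0 < \<epsilon> / 2" using \<epsilon> by simp
    obtain M where M: "0 < M" "\<And>t t'. (\<And>j. M \<le> t $ j) \<Longrightarrow> (\<And>j. M \<le> t' $ j) \<Longrightarrow>
        p (partial_laplace scl T P f lam t' - partial_laplace scl T P f lam t) < \<epsilon> / 2"
      using Cauchy[OF p \<open>0 < \<epsilon> / 2\<close>] by blast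
    \<comment> \<open>One diagonal corner that is both close to \<open>F\<close> and beyond
      \<open>M\<close> is compared with an arbitrary \<open>t\<close> beyond
      \<open>M\<close>.\<close>
    have "eventually (\<lambda>k. p (u k - F) < \<epsilon> / 2 \<and> nat \<lceil>M\<rceil> \<le> k) sequentially"
      using \<epsilon> by (intro eventually_conj order_tendstoD(2)[OF F[OF p]] eventually_ge_at_top) simp
    then obtain k where k: "p (u k - F) < \<epsilon> / 2" "nat \<lceil>M\<rceil> \<le> k"
      unfolding eventually_sequentially by blast
    have Mk: "M \<le> real k" using k(2) by linarith
    have "p (partial_laplace scl T P f lam t - F) < \<epsilon>" if t: "\<forall>j. M < t $ j" for t
    proof -
      have "p (partial_laplace scl T P f lam t - u k) < \<epsilon> / 2"
        unfolding u_def using t Mk by (intro M(2)) (auto simp: less_imp_le)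
      then show ?thesis
        using p_triangle_diff[OF p, of "partial_laplace scl T P f lam t" F "u k"] k(1) by simp
    qed
    then show ?thesis using M(1) by blast
  qed
  then show "lam \<in> Omega scl T P f"
    unfolding Omega_def by blast
qed

end
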